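(* Let $\mathbf M$ be an ascending Motzkin path with $m_1=0$ and let $T_{\mathbf M}$, its edge weights and its lattice paths be as defined in the context. Let $1\le k\le r$ and $n\ge k-1$, and put $A_i=(2i-2,0)$, $E_i=(2n+2k-2i,0)$ for $i=1,\dots,k$. Then $$R_{k,n}=(R_{1,0})^k\sum_{(P_1,\dots,P_k)}\prod_{i=1}^k w(P_i),$$ the sum running over all $k$-tuples of $T_{\mathbf M}$-lattice paths such that $P_i$ goes from $A_i$ to $E_i$ and no two of the paths share a vertex, where $w(P)$ is the product of the weights of the steps of $P$. (For $k=1$ this says $R_{1,n}/R_{1,0}$ is the weighted count of $T_{\mathbf M}$-lattice paths from $(0,0)$ to $(2n,0)$.)
   Context: Fix $r\ge1$, $I_r=\{1,\dots,r\}$, and let $(R_{\alpha,n})$ be the $A_r$ $Q$-system: $R_{0,n}=R_{r+1,n}=1$, $R_{\alpha,n+1}R_{\alpha,n-1}=R_{\alpha,n}^2+R_{\alpha+1,n}R_{\alpha-1,n}$ ($\alpha\in I_r$, $n\in\mathbb Z$), viewed as rational functions of $2r$ algebraically independent initial values. An ascending Motzkin path is $\mathbf M=(m_1,\dots,m_r)\in\mathbb Z^r$ with $m_{\alpha+1}-m_\alpha\in\{0,1\}$; here $m_1=0$. Its initial data are $R_{\alpha,m_\alpha},R_{\alpha,m_\alpha+1}$ ($\alpha\in I_r$). Weights: with $\lambda_{\alpha,n}=R_{\alpha,n+1}/R_{\alpha,n}$ and $\mu_{\alpha,n}=R_{\alpha,n}/R_{\alpha-1,n}$ (so $\lambda_{0,n}=\lambda_{r+1,n}=1$),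 and any value for $m_0,m_{r+1}$, set $y_{2\alpha-1}=\lambda_{\alpha,m_\alpha}/\lambda_{\alpha-1,m_{\alpha-1}}$ for $1\le\alpha\le r+1$ and $y_{2\alpha}=\mu_{\alpha+1,m_\alpha+1}/\mu_{\alpha,m_\alpha}$ for $1\le\alpha\le r$. The tree $T_{\mathbf M}$: let $H=\{\alpha\in\{2,\dots,r\}: m_\alpha=m_{\alpha-1}\}$, $s=|H|$, $N=2r+1-s$. It has $2r+1$ edges labelled $1,\dots,2r+1$; edge $2\alpha-1$ with $\alpha\in H$ is called horizontal, all others vertical. The $N$ vertical edges, in increasing order of label, form a path with vertices $v_0,v_1,\dots,v_N$ (the $k$-th vertical edge joins $v_{k-1}$ and $v_k$; $v_k$ has height $k$). For each $\alpha\in H$ the horizontal edge $2\alpha-1$ joins a new leaf vertex to the upper endpoint of edge $2\alpha-2$. Traversing edge $e$ toward $v_0$ (from $v_k$ to $v_{k-1}$, or from a leaf to the chain) has weight $y_e$; traversing it away from $v_0$ has weight $1$. $T_{\mathbf M}$-lattice paths: sequences of lattice points of $\mathbb Z^2$ with heights in $[0,N]$, using steps $(x,h)\to(x+1,h+1)$ (weight $1$, allowed if $h<N$), $(x,h)\to(x+1,h-1)$ (weight $y_e$ for the vertical edge $e$ joining $v_{h-1},v_h$), and $(x,h)\to(x+2,h)$ (allowed only if a horizontal edge $e$ is attached at $v_h$, weight $y_e$). The vertices of a path are the endpoints of its steps. *)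

theory Defs
  imports Main
begin

definition qsys :: "nat \<Rightarrow> (nat \<Rightarrow> int \<Rightarrow> 'a::field) \<Rightarrow> bool" where
  "qsys r R \<longleftrightarrow> (\<forall>n. R 0 n = 1 \<and> R (r+1) n = 1) \<and>
     (\<forall>\<alpha>\<in>{1..r}. \<forall>n. R \<alpha> (n+1) * R \<alpha> (n-1) = (R \<alpha> n)^2 + R (\<alpha>+1) n * R (\<alpha>-1) n)"

text \<open>Ascending Motzkin path (m 1, ..., m r) with m 1 = 0; values m 0, m (r+1) arbitrary.\<close>
definition asc_motzkin :: "nat \<Rightarrow> (nat \<Rightarrow> int) \<Rightarrow> bool" where
  "asc_motzkin r m \<longleftrightarrow> m 1 = 0 \<and> (\<forall>\<alpha>\<in>{1..<r}. m (\<alpha>+1) - m \<alpha> \<in> {0,1})"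

definition lam :: "(nat \<Rightarrow> int \<Rightarrow> 'a::field) \<Rightarrow> nat \<Rightarrow> int \<Rightarrow> 'a" where
  "lam R \<alpha> n = R \<alpha> (n+1) / R \<alpha> n"

definition mu :: "(nat \<Rightarrow> int \<Rightarrow> 'a::field) \<Rightarrow> nat \<Rightarrow> int \<Rightarrow> 'a" where
  "mu R \<alpha> n = R \<alpha> n / R (\<alpha>-1) n"

definition yw :: "(nat \<Rightarrow> int) \<Rightarrow> (nat \<Rightarrow> int \<Rightarrow> 'a::field) \<Rightarrow> nat \<Rightarrow> 'a" where
  "yw m R e = (if odd e then
       (let \<alpha> = (e+1) div 2 in lam R \<alpha> (m \<alpha>) / lam R (\<alpha>-1) (m (\<alpha>-1)))
     else (let \<alpha> = e div 2 in mu R (\<alpha>+1) (m \<alpha> + 1) / mu R \<alpha> (m \<alpha>)))"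

definition hset :: "nat \<Rightarrow> (nat \<Rightarrow> int) \<Rightarrow> nat set" where
  "hset r m = {\<alpha>\<in>{2..r}. m \<alpha> = m (\<alpha>-1)}"

definition vertical :: "nat \<Rightarrow> (nat \<Rightarrow> int) \<Rightarrow> nat \<Rightarrow> bool" where
  "vertical r m e \<longleftrightarrow> e \<in> {1..2*r+1} \<and> \<not> (odd e \<and> (e+1) div 2 \<in> hset r m)"

text \<open>Position of a vertical edge in increasing order of labels: the k-th vertical edge
  joins v_(k-1) and v_k.\<close>
definition vpos :: "nat \<Rightarrow> (nat \<Rightarrow> int) \<Rightarrow> nat \<Rightarrow> nat" where
  "vpos r m e = card {e'\<in>{1..e}. vertical r m e'}"

definition NN :: "nat \<Rightarrow> (nat \<Rightarrow> int) \<Rightarrow> nat" where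
  "NN r m = 2*r + 1 - card (hset r m)"

text \<open>Weight of a down step from height h (traversing the vertical edge joining v_(h-1), v_h).\<close>
definition down_wt :: "nat \<Rightarrow> (nat \<Rightarrow> int) \<Rightarrow> (nat \<Rightarrow> int \<Rightarrow> 'a::field) \<Rightarrow> int \<Rightarrow> 'a" where
  "down_wt r m R h = yw m R (THE e. vertical r m e \<and> int (vpos r m e) = h)"

text \<open>A horizontal edge 2 alpha - 1 is attached at the upper endpoint v_(vpos (2 alpha - 2)).\<close>
definition has_horiz :: "nat \<Rightarrow> (nat \<Rightarrow> int) \<Rightarrow> int \<Rightarrow> bool" where
  "has_horiz r m h \<longleftrightarrow> (\<exists>\<alpha>\<in>hset r m. int (vpos r m (2*\<alpha>-2)) = h)"

definition horiz_wt :: "nat \<Rightarrow> (nat \<Rightarrow> int) \<Rightarrow> (nat \<Rightarrow> int \<Rightarrow> 'a::field) \<Rightarrow> int \<Rightarrow> 'a" where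
  "horiz_wt r m R h = yw m R (2 * (THE \<alpha>. \<alpha> \<in> hset r m \<and> int (vpos r m (2*\<alpha>-2)) = h) - 1)"

definition step_ok :: "nat \<Rightarrow> (nat \<Rightarrow> int) \<Rightarrow> int \<times> int \<Rightarrow> int \<times> int \<Rightarrow> bool" where
  "step_ok r m p q \<longleftrightarrow>
     (fst q = fst p + 1 \<and> snd q = snd p + 1 \<and> snd p < int (NN r m)) \<or>
     (fst q = fst p + 1 \<and> snd q = snd p - 1 \<and> snd p \<ge> 1) \<or>
     (fst q = fst p + 2 \<and> snd q = snd p \<and> has_horiz r m (snd p))"

definition step_wt :: "nat \<Rightarrow> (nat \<Rightarrow> int) \<Rightarrow> (nat \<Rightarrow> int \<Rightarrow> 'a::field) \<Rightarrow> int \<times> int \<Rightarrow> int \<times> int \<Rightarrow> 'a" where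
  "step_wt r m R p q = (if snd q = snd p + 1 then 1
      else if snd q = snd p - 1 then down_wt r m R (snd p)
      else horiz_wt r m R (snd p))"

definition is_lpath :: "nat \<Rightarrow> (nat \<Rightarrow> int) \<Rightarrow> (int \<times> int) list \<Rightarrow> int \<times> int \<Rightarrow> int \<times> int \<Rightarrow> bool" where
  "is_lpath r m P A E \<longleftrightarrow> P \<noteq> [] \<and> hd P = A \<and> last P = E \<and>
     (\<forall>p\<in>set P. 0 \<le> snd p \<and> snd p \<le> int (NN r m)) \<and>
     (\<forall>i < length P - 1. step_ok r m (P!i) (P!(i+1)))"

definition path_wt :: "nat \<Rightarrow> (nat \<Rightarrow> int) \<Rightarrow> (nat \<Rightarrow> int \<Rightarrow> 'a::field) \<Rightarrow> (int \<times> int) list \<Rightarrow> 'a" where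
  "path_wt r m R P = (\<Prod>i < length P - 1. step_wt r m R (P!i) (P!(i+1)))"

end

theory Submission
  imports Defs "Jordan_Normal_Form.Determinant"
begin

text \<open>The sequence \<open>a\<^sub>n = R\<^sub>1\<^sub>,\<^sub>n\<close> determines the whole Q-system: \<open>R\<^sub>k\<^sub>,\<^sub>n\<close> is the \<open>k \<times> k\<close> Hankel determinant
  of \<open>a\<close> centred at \<open>n\<close>. Replacing the last column of such a determinant by the column starting at
  \<open>a\<^sub>j\<close> gives functions of \<open>j\<close> (values of the moment functional on orthogonal Laurent polynomials) that
  satisfy contiguity relations and vanish identically in size \<open>r + 2\<close>. A Motzkin path selects one
  such function for each vertex of the tree; the contiguity relations then become exactly
  the recursion, by first steps, for the weighted count of lattice paths down to height \<open>0\<close>. This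
  is the case \<open>k = 1\<close>. For general \<open>k\<close>, the Lindstrom-Gessel-Viennot lemma turns the Hankel determinant
  of path counts into a sum over disjoint families: by parity of \<open>x + h\<close>, crossing
  paths share a vertex even though horizontal steps skip an abscissa, so only the identity permutation survives.\<close>

section \<open>The Lindstrom-Gessel-Viennot lemma\<close>

definition paths :: "('v \<Rightarrow> 'v \<Rightarrow> bool) \<Rightarrow> 'v \<Rightarrow> 'v \<Rightarrow> 'v list set" where
  "paths step a b = {P. P \<noteq> [] \<and> hd P = a \<and> last P = b \<and> successively step P}"

fun weight :: "('v \<Rightarrow> 'v \<Rightarrow> 'a::comm_ring_1) \<Rightarrow> 'v list \<Rightarrow> 'a" where
  "weight w (p # q # P) = w p q * weight w (q # P)"
| "weight w _ = 1"

definition path_sum :: "('v \<Rightarrow> 'v \<Rightarrow> bool) \<Rightarrow> ('v \<Rightarrow> 'v \<Rightarrow> 'a::comm_ring_1) \<Rightarrow> 'v \<Rightarrow> 'v \<Rightarrow> 'a" where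
  "path_sum step w a b = (\<Sum>P\<in>paths step a b. weight w P)"

lemma weight_conv_prod: "weight w P = (\<Prod>i<length P - 1. w (P ! i) (P ! (i + 1)))"
  by (induction w P rule: weight.induct) (auto simp: prod.lessThan_Suc_shift simp del: prod.lessThan_Suc)

lemma weight_append: "weight w (P @ v # P') = weight w (P @ [v]) * weight w (v # P')"
  by (induction w P rule: weight.induct) (auto simp: mult.assoc)

definition splice_at :: "'v \<Rightarrow> 'v list \<Rightarrow> 'v list \<Rightarrow> 'v list" where
  "splice_at v P P' = takeWhile (\<lambda>u. u \<noteq> v) P @ dropWhile (\<lambda>u. u \<noteq> v) P'"

lemma path_split:
  assumes "v \<in> set P"
  obtains P1 P2 where "P = P1 @ v # P2" "v \<notin> set P1"
    "takeWhile (\<lambda>u. u \<noteq> v) P = P1" "dropWhile (\<lambda>u. u \<noteq> v) P = v # P2"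
proof -
  obtain P1 P2 where P: "P = P1 @ v # P2" "v \<notin> set P1"
    using split_list_first[OF assms] by blast
  then have "takeWhile (\<lambda>u. u \<noteq> v) P = P1" "dropWhile (\<lambda>u. u \<noteq> v) P = v # P2"
    by (auto simp: takeWhile_append dropWhile_append)
  with P that show thesis by blast
qed

text \<open>Both paths are cut at their first visit to \<open>v\<close>. The two splices consist of
  the same pieces as the two paths, which preserves weights and vertex counts; neither head contains
  \<open>v\<close>, so cutting the splices at \<open>v\<close> finds the same pieces again.\<close>

lemma splice_at:
  assumes "v \<in> set P" "v \<in> set P'" "P \<in> paths step a b" "P' \<in> paths step a' b'"
  shows splice_at_paths: "splice_at v P P' \<in> paths step a b'"
    and splice_at_mem: "v \<in> set (splice_at v P P')"
    and splice_at_weight: "weight w (splice_at v P P') * weight w (splice_at v P' P) = weight w P * weight w P'"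
    and splice_at_count: "count_list (splice_at v P P') u + count_list (splice_at v P' P) u = count_list P u + count_list P' u"
    and splice_at_splice_at: "splice_at v (splice_at v P P') (splice_at v P' P) = P"
proof -
  obtain P1 P2 where P: "P = P1 @ v # P2" "v \<notin> set P1"
    "takeWhile (\<lambda>u. u \<noteq> v) P = P1" "dropWhile (\<lambda>u. u \<noteq> v) P = v # P2"
    using path_split[OF assms(1)] by blast
  obtain P1' P2' where P': "P' = P1' @ v # P2'" "v \<notin> set P1'"
    "takeWhile (\<lambda>u. u \<noteq> v) P' = P1'" "dropWhile (\<lambda>u. u \<noteq> v) P' = v # P2'"
    using path_split[OF assms(2)] by blast
  have S: "splice_at v P P' = P1 @ v # P2'" "splice_at v P' P = P1' @ v # P2"
    by (simp_all add: splice_at_def P(3,4) P'(3,4))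
  show "splice_at v P P' \<in> paths step a b'"
    using assms(3,4) unfolding S unfolding P(1) P'(1) paths_def
    by (auto simp: successively_append_iff hd_append split: if_splits)
  show "v \<in> set (splice_at v P P')" by (simp add: S)
  show "weight w (splice_at v P P') * weight w (splice_at v P' P) = weight w P * weight w P'"
    unfolding S unfolding P(1) P'(1) weight_append[of w P1 v P2] weight_append[of w P1 v P2']
      weight_append[of w P1' v P2] weight_append[of w P1' v P2'] by (simp add: mult_ac)
  show "count_list (splice_at v P P') u + count_list (splice_at v P' P) u = count_list P u + count_list P' u"
    unfolding S unfolding P(1) P'(1) by simp
  show "splice_at v (splice_at v P P') (splice_at v P' P) = P"
    unfolding S unfolding P(1) using P(2) P'(2)
    by (auto simp: splice_at_def takeWhile_append dropWhile_append)
qed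

text \<open>The rank excludes cycles and, with finite branching, leaves finitely many paths between
  two points: \<open>path_sum\<close> is a genuine finite sum and can be unfolded by first
  steps.\<close>

locale ranked_steps =
  fixes step :: "'v \<Rightarrow> 'v \<Rightarrow> bool" and rank :: "'v \<Rightarrow> int"
  assumes rank_step: "step p q \<Longrightarrow> rank p < rank q"
    and finite_step: "finite {q. step p q}"
begin

lemma path_distinct:
  assumes "P \<in> paths step a b" shows "distinct P"
proof -
  have "successively (\<lambda>p q. rank p < rank q) P"
    using assms rank_step by (auto simp: paths_def intro: successively_mono)
  then have "sorted_wrt (\<lambda>p q. rank p < rank q) P"
    by (subst (asm) successively_conv_sorted_wrt) (auto simp: transp_def)
  then show ?thesis by (induction P) auto
qed

lemma rank_le_if_paths:
  assumes "P \<in> paths step a b" shows "rank a \<le> rank b"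
  using assms
proof (induction P arbitrary: a)
  case (Cons p P)
  show ?case
  proof (cases "P = []")
    case False
    then have "P \<in> paths step (hd P) b" "step a (hd P)"
      using Cons.prems by (auto simp: paths_def successively_Cons)
    then show ?thesis using Cons.IH rank_step by force
  qed (use Cons.prems in \<open>auto simp: paths_def\<close>)
qed (auto simp: paths_def)

lemma paths_unfold:
  "paths step a b = (if a = b then {[a]} else {}) \<union> (\<Union>c\<in>{c. step a c}. (#) a ` paths step c b)"
  (is "_ = ?R")
proof (intro Set.set_eqI iffI)
  fix P assume P: "P \<in> paths step a b"
  then obtain P' where P': "P = a # P'" by (cases P) (auto simp: paths_def)
  show "P \<in> ?R"
  proof (cases P')
    case Nil
    then show ?thesis using P P' by (auto simp: paths_def)
  next
    case (Cons c P'')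
    then have "step a c" "P' \<in> paths step c b" using P P' by (auto simp: paths_def)
    then show ?thesis using P' by blast
  qed
next
  fix P assume "P \<in> ?R"
  then show "P \<in> paths step a b"
    by (auto simp: paths_def successively_Cons split: if_splits)
qed

lemma paths_eq_empty: "rank b < rank a \<Longrightarrow> paths step a b = {}"
  using rank_le_if_paths by force

lemma finite_paths: "finite (paths step a b)"
proof (induction "nat (rank b - rank a + 1)" arbitrary: a rule: less_induct)
  case less
  show ?case
  proof (cases "rank b < rank a")
    case False
    have "finite (paths step c b)" if "step a c" for c
      using False rank_step[OF that] by (intro less) auto
    then show ?thesis by (subst paths_unfold) (use finite_step in auto)
  qed (simp add: paths_eq_empty)
qed

lemma path_sum_eq_0: "rank b < rank a \<Longrightarrow> path_sum step w a b = 0"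
  by (simp add: path_sum_def paths_eq_empty)

lemma path_sum_unfold:
  "path_sum step w a b = (if a = b then 1 else 0) + (\<Sum>c | step a c. w a c * path_sum step w c b)"
proof -
  have "path_sum step w a b = (\<Sum>P\<in>(if a = b then {[a]} else {}). weight w P) +
      (\<Sum>P\<in>(\<Union>c\<in>{c. step a c}. (#) a ` paths step c b). weight w P)"
    unfolding path_sum_def
    by (subst paths_unfold, rule sum.union_disjoint)
      (use finite_paths finite_step in \<open>auto simp: paths_def\<close>)
  also have "(\<Sum>P\<in>(\<Union>c\<in>{c. step a c}. (#) a ` paths step c b). weight w P) =
      (\<Sum>c | step a c. \<Sum>P\<in>(#) a ` paths step c b. weight w P)"
    by (rule sum.UNION_disjoint) (use finite_paths finite_step in \<open>auto simp: paths_def\<close>)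
  also have "\<dots> = (\<Sum>c | step a c. w a c * path_sum step w c b)"
  proof (rule sum.cong[OF refl])
    fix c
    have "(\<Sum>P\<in>(#) a ` paths step c b. weight w P) = (\<Sum>P\<in>paths step c b. weight w (a # P))"
      by (simp add: sum.reindex)
    also have "\<dots> = (\<Sum>P\<in>paths step c b. w a c * weight w P)"
      by (rule sum.cong[OF refl]) (auto simp: paths_def neq_Nil_conv)
    finally show "(\<Sum>P\<in>(#) a ` paths step c b. weight w P) = w a c * path_sum step w c b"
      by (simp add: path_sum_def sum_distrib_left)
  qed
  finally show ?thesis by auto
qed

end

section \<open>Intersecting families and the tail-swapping involution\<close>

definition families :: "('v \<Rightarrow> 'v \<Rightarrow> bool) \<Rightarrow> nat \<Rightarrow> (nat \<Rightarrow> 'v) \<Rightarrow> (nat \<Rightarrow> 'v) \<Rightarrow> (nat \<Rightarrow> 'v list) set" where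
  "families step k a b = (\<Pi>\<^sub>E i\<in>{0..<k}. paths step (a i) (b i))"

lemma families_mem: "f \<in> families step k a b \<Longrightarrow> i < k \<Longrightarrow> f i \<in> paths step (a i) (b i)"
  unfolding families_def by (rule PiE_mem) auto

lemma families_arb: "f \<in> families step k a b \<Longrightarrow> \<not> i < k \<Longrightarrow> f i = undefined"
  unfolding families_def by (rule PiE_arb) auto

definition vertex_disjoint :: "nat \<Rightarrow> (nat \<Rightarrow> 'v list) \<Rightarrow> bool" where
  "vertex_disjoint k f \<longleftrightarrow> (\<forall>i<k. \<forall>j<k. i \<noteq> j \<longrightarrow> set (f i) \<inter> set (f j) = {})"

definition carriers :: "nat \<Rightarrow> (nat \<Rightarrow> 'v list) \<Rightarrow> 'v \<Rightarrow> nat set" where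
  "carriers k f v = {i. i < k \<and> v \<in> set (f i)}"

text \<open>Counting occurrences with multiplicity makes this set depend only on the multiset of all
  vertices, hence visibly invariant under exchanging tails. Since ranked paths repeat no vertex, it
  still detects vertices shared by two different paths.\<close>

definition meeting_points :: "nat \<Rightarrow> (nat \<Rightarrow> 'v list) \<Rightarrow> 'v set" where
  "meeting_points k f = {v. 2 \<le> (\<Sum>i<k. count_list (f i) v)}"

text \<open>Swapping tails at \<open>v\<close> preserves both the multiset of all vertices of the family and the set of
  indices of paths through \<open>v\<close>; so an arbitrary but fixed choice of \<open>v\<close> from the meeting points
  and of the two least indices makes the swap an involution.\<close>

definition tail_swap :: "nat \<Rightarrow> (nat \<Rightarrow> nat) \<times> (nat \<Rightarrow> 'v list) \<Rightarrow> (nat \<Rightarrow> nat) \<times> (nat \<Rightarrow> 'v list)" where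
  "tail_swap k = (\<lambda>(\<sigma>, f).
    let v = (SOME v. v \<in> meeting_points k f);
        i = Min (carriers k f v);
        j = Min (carriers k f v - {i})
    in (\<sigma> \<circ> transpose i j, f(i := splice_at v (f i) (f j), j := splice_at v (f j) (f i))))"

context ranked_steps
begin

lemma count_list_path:
  assumes "f \<in> families step k a b" "i < k"
  shows "count_list (f i) v = (if v \<in> set (f i) then 1 else 0)"
proof -
  have "distinct (f i)" using families_mem[OF assms] by (rule path_distinct)
  moreover have "distinct xs \<Longrightarrow> count_list xs v = (if v \<in> set xs then 1 else 0)" for xs
    by (induction xs) auto
  ultimately show ?thesis by simp
qed

lemma meeting_points_iff:
  assumes "f \<in> families step k a b"
  shows "v \<in> meeting_points k f \<longleftrightarrow> 2 \<le> card (carriers k f v)"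
proof -
  have "(\<Sum>i<k. count_list (f i) v) = (\<Sum>i<k. if v \<in> set (f i) then 1 else 0)"
    by (intro sum.cong refl) (use count_list_path[OF assms] in simp)
  also have "\<dots> = card (carriers k f v)"
    by (simp add: carriers_def sum.If_cases Int_def lessThan_def)
  finally show ?thesis by (simp add: meeting_points_def)
qed

lemma vertex_disjoint_iff:
  assumes "f \<in> families step k a b"
  shows "vertex_disjoint k f \<longleftrightarrow> meeting_points k f = {}"
proof -
  have "2 \<le> card (carriers k f v) \<longleftrightarrow> (\<exists>i<k. \<exists>j<k. i \<noteq> j \<and> v \<in> set (f i) \<and> v \<in> set (f j))" for v
  proof -
    have "finite (carriers k f v)" by (simp add: carriers_def)
    then have "card (carriers k f v) \<le> Suc 0 \<longleftrightarrow> (\<forall>i\<in>carriers k f v. \<forall>j\<in>carriers k f v. i = j)"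
      by (rule card_le_Suc0_iff_eq)
    moreover have "2 \<le> card (carriers k f v) \<longleftrightarrow> \<not> card (carriers k f v) \<le> Suc 0" by auto
    ultimately show ?thesis by (auto simp: carriers_def)
  qed
  then show ?thesis
    using meeting_points_iff[OF assms] unfolding vertex_disjoint_def by blast
qed

lemma tail_swap:
  fixes w :: "'v \<Rightarrow> 'v \<Rightarrow> 'c::comm_ring_1"
  assumes \<sigma>: "\<sigma> permutes {0..<k}" and f: "f \<in> families step k a (b \<circ> \<sigma>)"
    and meet: "\<not> vertex_disjoint k f"
    and swap: "tail_swap k (\<sigma>, f) = (\<sigma>', f')"
  shows "\<sigma>' permutes {0..<k}" "f' \<in> families step k a (b \<circ> \<sigma>')" "\<not> vertex_disjoint k f'"
    "sign \<sigma>' = - sign \<sigma>" "tail_swap k (\<sigma>', f') = (\<sigma>, f)"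
    "(\<Prod>i<k. weight w (f' i)) = (\<Prod>i<k. weight w (f i))"
proof -
  define v where "v = (SOME v. v \<in> meeting_points k f)"
  define C where "C = carriers k f v"
  define i where "i = Min C"
  define j where "j = Min (C - {i})"
  have \<sigma>': "\<sigma>' = \<sigma> \<circ> transpose i j"
    and f': "f' = f(i := splice_at v (f i) (f j), j := splice_at v (f j) (f i))"
    using swap by (auto simp: tail_swap_def Let_def v_def C_def i_def j_def)
  have "meeting_points k f \<noteq> {}" using meet vertex_disjoint_iff[OF f] by simp
  then have vm: "v \<in> meeting_points k f" unfolding v_def by (simp add: some_in_eq)
  then have C2: "2 \<le> card C" using meeting_points_iff[OF f] by (simp add: C_def)
  have finC: "finite C" by (simp add: C_def carriers_def)
  have iC: "i \<in> C" unfolding i_def using finC C2 by (intro Min_in) auto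
  have "C - {i} \<noteq> {}" using C2 iC finC
    by (metis One_nat_def card.empty card_Suc_Diff1 le_numeral_extra(4) not_less_eq_eq numeral_2_eq_2)
  then have "j \<in> C - {i}" unfolding j_def using finC by (intro Min_in) auto
  then have jC: "j \<in> C" and ij: "i \<noteq> j" by auto
  have ik: "i < k" and vi: "v \<in> set (f i)" using iC by (auto simp: C_def carriers_def)
  have jk: "j < k" and vj: "v \<in> set (f j)" using jC by (auto simp: C_def carriers_def)
  have Pi: "f i \<in> paths step (a i) (b (\<sigma> i))" and Pj: "f j \<in> paths step (a j) (b (\<sigma> j))"
    using families_mem[OF f ik] families_mem[OF f jk] by simp_all
  note S = splice_at[OF vi vj Pi Pj] splice_at[OF vj vi Pj Pi]
  show p': "\<sigma>' permutes {0..<k}"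
    unfolding \<sigma>' using ik jk by (intro permutes_compose[OF _ \<sigma>] permutes_swap_id) auto
  show "sign \<sigma>' = - sign \<sigma>"
  proof -
    have "permutation \<sigma>" using \<sigma> permutation_permutes by blast
    then show ?thesis unfolding \<sigma>' using ij by (simp add: sign_compose permutation_swap_id sign_swap_id)
  qed
  show f'fam: "f' \<in> families step k a (b \<circ> \<sigma>')"
    unfolding families_def
  proof (rule PiE_I)
    fix l assume "l \<in> {0..<k}"
    then have "f l \<in> paths step (a l) (b (\<sigma> l))"
      using families_mem[OF f, of l] by simp
    then show "f' l \<in> paths step (a l) ((b \<circ> \<sigma>') l)"
      using S(1,6) ij by (auto simp: f' \<sigma>' transpose_def)
  next
    fix l assume "l \<notin> {0..<k}"
    then show "f' l = undefined"
      using families_arb[OF f, of l] ik jk by (auto simp: f')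
  qed
  have two: "sum g {..<k} = g i + g j + sum g ({..<k} - {i, j})" for g :: "nat \<Rightarrow> nat"
    using ik jk ij by (subst sum.subset_diff[of "{i, j}"]) auto
  have "(\<Sum>l<k. count_list (f' l) u) = (\<Sum>l<k. count_list (f l) u)" for u
  proof -
    have "(\<Sum>l\<in>{..<k} - {i, j}. count_list (f' l) u) = (\<Sum>l\<in>{..<k} - {i, j}. count_list (f l) u)"
      by (intro sum.cong) (auto simp: f')
    then show ?thesis unfolding two using S(4)[of u] ij by (simp add: f')
  qed
  then have mp: "meeting_points k f' = meeting_points k f" by (simp add: meeting_points_def)
  then show "\<not> vertex_disjoint k f'"
    using meet vertex_disjoint_iff[OF f] vertex_disjoint_iff[OF f'fam] by simp
  have C': "carriers k f' v = C"
    using S(2,7) vi vj ik jk by (auto simp: C_def carriers_def f')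
  have "f'(i := splice_at v (f' i) (f' j), j := splice_at v (f' j) (f' i)) = f"
    using S(5,10) ij by (auto simp: f')
  moreover have "\<sigma>' \<circ> transpose i j = \<sigma>" by (simp add: \<sigma>' comp_assoc)
  ultimately show "tail_swap k (\<sigma>', f') = (\<sigma>, f)"
    unfolding tail_swap_def prod.case mp v_def[symmetric] Let_def C' i_def[symmetric] j_def[symmetric]
    by simp
  have two': "prod g {..<k} = g i * g j * prod g ({..<k} - {i, j})" for g :: "nat \<Rightarrow> 'c::comm_ring_1"
    using ik jk ij by (subst prod.subset_diff[of "{i, j}"]) (auto simp: mult_ac)
  have "(\<Prod>l\<in>{..<k} - {i, j}. weight w (f' l)) = (\<Prod>l\<in>{..<k} - {i, j}. weight w (f l))"
    by (intro prod.cong) (auto simp: f')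
  then show "(\<Prod>i<k. weight w (f' i)) = (\<Prod>i<k. weight w (f i))"
    unfolding two' using S(3)[of w] ij by (simp add: f')
qed

text \<open>The determinant expands into a signed sum over pairs of a permutation and a family.
  Pairs with a shared vertex cancel under \<open>tail_swap\<close>, which reverses the sign and
  keeps the weight; \<open>compatible\<close> leaves only the identity among the others.\<close>

theorem lindstrom_gessel_viennot:
  fixes w :: "'v \<Rightarrow> 'v \<Rightarrow> 'a::comm_ring_1"
  assumes compatible: "\<And>\<sigma> f. \<sigma> permutes {0..<k} \<Longrightarrow> f \<in> families step k a (b \<circ> \<sigma>) \<Longrightarrow>
      vertex_disjoint k f \<Longrightarrow> \<sigma> = id"
  shows "det (mat k k (\<lambda>(i, j). path_sum step w (a i) (b j))) =
    (\<Sum>f | f \<in> families step k a b \<and> vertex_disjoint k f. \<Prod>i<k. weight w (f i))"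
proof -
  define All where "All = (SIGMA \<sigma>:{\<sigma>. \<sigma> permutes {0..<k}}. families step k a (b \<circ> \<sigma>))"
  \<comment> \<open>Splitting by sign turns the cancellation into a bijection between
    \<open>Bad 1\<close> and \<open>Bad (- 1)\<close>; an argument of the form S = -S would fail in
    characteristic 2.\<close>
  define Bad where "Bad s = {(\<sigma>, f) \<in> All. sign \<sigma> = s \<and> \<not> vertex_disjoint k f}" for s :: int
  define Good where "Good = {(\<sigma>, f) \<in> All. vertex_disjoint k f}"
  define W where "W = (\<lambda>(\<sigma> :: nat \<Rightarrow> nat, f). \<Prod>i<k. weight w (f i))"
  define SW where "SW = (\<lambda>x. signof (fst x) * W x)"
  have finp: "finite {\<sigma>. \<sigma> permutes {0..<k}}" by (simp add: finite_permutations)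
  have finf: "finite (families step k a b)" for b
    unfolding families_def by (intro finite_PiE) (auto simp: finite_paths)
  have finA: "finite All" unfolding All_def using finp finf by auto
  have "det (mat k k (\<lambda>(i, j). path_sum step w (a i) (b j)))
    = (\<Sum>\<sigma> | \<sigma> permutes {0..<k}. signof \<sigma> * (\<Prod>i = 0..<k. path_sum step w (a i) (b (\<sigma> i))))"
  proof (subst det_def'[of _ k], simp, intro sum.cong refl arg_cong2[of _ _ _ _ "(*)"] prod.cong)
    fix \<sigma> i assume "\<sigma> \<in> {\<sigma>. \<sigma> permutes {0..<k}}" "i \<in> {0..<k}"
    then have "i < k" "\<sigma> i < k" using permutes_in_image[of \<sigma> "{0..<k}" i] by auto
    then show "mat k k (\<lambda>(i, j). path_sum step w (a i) (b j)) $$ (i, \<sigma> i)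
        = path_sum step w (a i) (b (\<sigma> i))" by simp
  qed
  \<comment> \<open>Families are extensional functions, so the product of path sums expands by
    \<open>prod_sum_PiE\<close> into a single sum over families.\<close>
  also have "\<dots> = (\<Sum>\<sigma> | \<sigma> permutes {0..<k}. \<Sum>f\<in>families step k a (b \<circ> \<sigma>). SW (\<sigma>, f))"
    unfolding path_sum_def families_def
    by (subst prod_sum_PiE) (auto simp: finite_paths SW_def W_def sum_distrib_left atLeast0LessThan)
  also have "\<dots> = sum SW All"
    unfolding All_def using finp finf by (simp add: sum.Sigma)
  also have "All = Good \<union> (Bad 1 \<union> Bad (- 1))"
    unfolding Good_def Bad_def by (auto simp: sign_def split: if_splits)
  also have "sum SW \<dots> = sum SW Good + (sum SW (Bad 1) + sum SW (Bad (- 1)))"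
  proof -
    have "finite Good" "finite (Bad s)" for s
      by (rule finite_subset[OF _ finA]; auto simp: Good_def Bad_def)+
    moreover have "Good \<inter> (Bad 1 \<union> Bad (- 1)) = {}" "Bad 1 \<inter> Bad (- 1) = {}"
      by (auto simp: Good_def Bad_def)
    ultimately show ?thesis by (simp add: sum.union_disjoint)
  qed
  also have "sum SW (Bad (- 1)) = - sum W (Bad (- 1))"
    unfolding sum_negf[symmetric] by (rule sum.cong) (auto simp: Bad_def SW_def)
  also have "sum SW (Bad 1) = sum W (Bad 1)"
    by (rule sum.cong) (auto simp: Bad_def SW_def)
  also have "sum W (Bad 1) = sum W (Bad (- 1))"
  proof -
    have ts: "tail_swap k x \<in> Bad (- s) \<and> tail_swap k (tail_swap k x) = x \<and> W (tail_swap k x) = W x"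
      if "x \<in> Bad s" for x s
    proof -
      obtain \<sigma> f \<sigma>' f' where x: "x = (\<sigma>, f)" and swap: "tail_swap k (\<sigma>, f) = (\<sigma>', f')"
        by (metis surj_pair)
      have H: "\<sigma> permutes {0..<k}" "f \<in> families step k a (b \<circ> \<sigma>)" "\<not> vertex_disjoint k f" "sign \<sigma> = s"
        using that by (auto simp: x Bad_def All_def)
      note T = tail_swap[OF H(1-3) swap]
      show ?thesis unfolding x swap using T(1-5) T(6)[of w] H(4) by (auto simp: Bad_def All_def W_def)
    qed
    show ?thesis
      by (rule sum.reindex_bij_witness[of _ "tail_swap k" "tail_swap k"])
        (use ts[of _ 1] ts[of _ "- 1"] in auto)
  qed
  also have "sum SW Good = (\<Sum>f | f \<in> families step k a b \<and> vertex_disjoint k f. \<Prod>i<k. weight w (f i))"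
  proof (rule sum.reindex_bij_witness[of _ "Pair id" snd])
    fix x assume "x \<in> Good"
    moreover from this have "fst x = id" using compatible by (auto simp: Good_def All_def)
    ultimately show "(id, snd x) = x" "snd x \<in> {f \<in> families step k a b. vertex_disjoint k f}"
      "(\<Prod>i<k. weight w (snd x i)) = SW x"
      by (auto simp: Good_def All_def SW_def W_def)
  qed (auto simp: Good_def All_def permutes_id)
  finally show ?thesis by simp
qed

end

section \<open>Hankel determinants of a Q-system\<close>

text \<open>Genericity of the initial data enters as nonvanishing of all values: every denominator
  below is built from them.\<close>

locale nonvanishing_qsys =
  fixes r :: nat and R :: "nat \<Rightarrow> int \<Rightarrow> 'a::field"
  assumes r_pos: "r \<ge> 1"
    and qsys: "qsys r R"
    and nonzero: "\<And>\<alpha> j. \<alpha> \<in> {1..r} \<Longrightarrow> R \<alpha> j \<noteq> 0"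
begin

text \<open>Extension by 0 beyond \<open>r + 1\<close> makes the Q-system relation hold at index
  \<open>r + 1\<close> as well, where it reads 1 = 1 + 0. The relations for \<open>W\<close> can
  then be pushed up to size \<open>r + 2\<close>.\<close>

definition Q :: "nat \<Rightarrow> int \<Rightarrow> 'a" where
  "Q \<alpha> n = (if \<alpha> \<le> r + 1 then R \<alpha> n else 0)"

lemma Q_0 [simp]: "Q 0 n = 1"
  using qsys by (simp add: Q_def qsys_def)

lemma Q_Suc_r [simp]: "Q (Suc r) n = 1"
  using qsys by (simp add: Q_def qsys_def)

lemma Q_Suc_Suc_r [simp]: "Q (Suc (Suc r)) n = 0"
  by (simp add: Q_def)

lemma Q_eq: "\<alpha> \<le> r + 1 \<Longrightarrow> Q \<alpha> n = R \<alpha> n"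
  by (simp add: Q_def)

lemma Q_nonzero:
  assumes "\<alpha> \<le> r + 1" shows "Q \<alpha> n \<noteq> 0"
proof -
  consider "\<alpha> = 0" | "\<alpha> = Suc r" | "\<alpha> \<in> {1..r}" using assms by fastforce
  then show ?thesis by cases (auto simp: nonzero Q_def[of \<alpha>])
qed

lemma Q_rel:
  assumes "a \<le> r"
  shows "Q (Suc a) (n + 1) * Q (Suc a) (n - 1) = Q (Suc a) n * Q (Suc a) n + Q (Suc (Suc a)) n * Q a n"
proof (cases "a = r")
  case False
  then have "Suc a \<in> {1..r}" using assms by auto
  with qsys have "R (Suc a) (n + 1) * R (Suc a) (n - 1)
      = (R (Suc a) n)^2 + R (Suc a + 1) n * R (Suc a - 1) n"
    unfolding qsys_def by blast
  with False assms show ?thesis by (simp add: Q_def power2_eq_square)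
qed simp

text \<open>In terms of the columns \<open>c\<^sub>s = (R\<^sub>1\<^sub>,\<^sub>s, \<dots>, R\<^sub>1\<^sub>,\<^sub>s\<^sub>+\<^sub>\<alpha>\<^sub>-\<^sub>1)\<close>, the quantity \<open>W \<alpha> n j\<close> is the determinant of
  the columns with \<open>s = n - \<alpha> + 1, \<dots>, n - 1, j\<close>; the recursion is a Plucker relation.\<close>

fun W :: "nat \<Rightarrow> int \<Rightarrow> int \<Rightarrow> 'a" where
  "W 0 n j = 0"
| "W (Suc 0) n j = R 1 j"
| "W (Suc (Suc a)) n j =
    (Q (Suc a) (n - 1) * W (Suc a) (n + 1) (j + 1) - Q (Suc a) n * W (Suc a) n j) / Q a n"

section \<open>Contiguity relations and zeros of \<open>W\<close>\<close>

lemma W_rec: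
  assumes "a \<le> r"
  shows "Q a n * W (Suc (Suc a)) n j =
    Q (Suc a) (n - 1) * W (Suc a) (n + 1) (j + 1) - Q (Suc a) n * W (Suc a) n j"
  using Q_nonzero[of a n] assms by simp

text \<open>Both relations are proved in one induction, since each of them in the next size needs
  both in the current one, besides the recursion for \<open>W\<close> and the Q-system
  relation.\<close>

lemma W_relations:
  assumes "a \<le> r + 1"
  shows "Q a n * W (Suc a) n j - Q a (n - 1) * W (Suc a) (n + 1) j = Q (Suc a) n * W a n j"
    and "Q a (n + 1) * W (Suc a) n j - Q a n * W (Suc a) (n + 1) j
      = Q (Suc a) n * W a (n + 1) (j + 1)"
  using assms
proof (induction a arbitrary: n j)
  case 0
  { case 1 show ?case by simp }
  { case 2 show ?case by simp }
next
  case (Suc a)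
  \<comment> \<open>Here \<open>p0\<close>, \<open>p1\<close> stand for \<open>Q a\<close> at
    \<open>n\<close>, \<open>n + 1\<close>, and \<open>qm\<close>, \<open>q0\<close>,
    \<open>q1\<close> for \<open>Q (Suc a)\<close> at \<open>n - 1\<close>, \<open>n\<close>,
    \<open>n + 1\<close>. The first relation at \<open>(n + 1, j + 1)\<close> and the second at
    \<open>(n, j)\<close> contain the same value \<open>w = W a (n + 1) (j + 1)\<close>, which is
    eliminated.\<close>
  have aux1: "q0 * A - qm * B = s * X0" and aux2: "q1 * A - q0 * B = s * X1'"
    if "p0 * A = qm * X1' - q0 * X0" "p1 * B = q0 * X2' - q1 * X1"
      "p1 * X1' - p0 * X2' = q1 * w" "p1 * X0 - p0 * X1 = q0 * w"
      "q1 * qm = q0 * q0 + s * p0" "p0 \<noteq> 0" "p1 \<noteq> 0"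
    for p0 p1 qm q0 q1 s A B X0 X1 X1' X2' w :: 'a
  proof -
    have "p0 * p1 * (q0 * A - qm * B) = q0 * p1 * (p0 * A) - qm * p0 * (p1 * B)"
      by (simp add: algebra_simps)
    also have "\<dots> = q0 * qm * (p1 * X1' - p0 * X2') + (q1 * qm * (p0 * X1) - q0 * q0 * (p1 * X0))"
      unfolding that(1,2) by (simp add: algebra_simps)
    also have "\<dots> = q1 * qm * (q0 * w) + (q1 * qm * (p0 * X1) - q0 * q0 * (p1 * X0))"
      unfolding that(3) by (simp add: algebra_simps)
    also have "\<dots> = (q1 * qm - q0 * q0) * (p1 * X0)"
      unfolding that(4)[symmetric] by (simp add: algebra_simps)
    also have "\<dots> = p0 * p1 * (s * X0)"
      unfolding that(5) by (simp add: algebra_simps)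
    finally have "p0 * p1 * (q0 * A - qm * B) = p0 * p1 * (s * X0)" .
    then show "q0 * A - qm * B = s * X0" using that by simp
    have "p0 * p1 * (q1 * A - q0 * B) = q1 * p1 * (p0 * A) - q0 * p0 * (p1 * B)"
      by (simp add: algebra_simps)
    also have "\<dots> = q1 * qm * (p1 * X1') - q0 * q0 * (p0 * X2') - q0 * q1 * (p1 * X0 - p0 * X1)"
      unfolding that(1,2) by (simp add: algebra_simps)
    also have "\<dots> = q1 * qm * (p1 * X1') - q0 * q0 * (p0 * X2') - q0 * q0 * (q1 * w)"
      unfolding that(4) by (simp add: algebra_simps)
    also have "\<dots> = (q1 * qm - q0 * q0) * (p1 * X1')"
      unfolding that(3)[symmetric] by (simp add: algebra_simps)
    also have "\<dots> = p0 * p1 * (s * X1')"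
      unfolding that(5) by (simp add: algebra_simps)
    finally have "p0 * p1 * (q1 * A - q0 * B) = p0 * p1 * (s * X1')" .
    then show "q1 * A - q0 * B = s * X1'" using that by simp
  qed
  have rels: "Q a n * W (Suc (Suc a)) n j =
      Q (Suc a) (n - 1) * W (Suc a) (n + 1) (j + 1) - Q (Suc a) n * W (Suc a) n j"
    "Q a (n + 1) * W (Suc (Suc a)) (n + 1) j =
      Q (Suc a) n * W (Suc a) (n + 2) (j + 1) - Q (Suc a) (n + 1) * W (Suc a) (n + 1) j"
    "Q a (n + 1) * W (Suc a) (n + 1) (j + 1) - Q a n * W (Suc a) (n + 2) (j + 1)
      = Q (Suc a) (n + 1) * W a (n + 1) (j + 1)"
    "Q a (n + 1) * W (Suc a) n j - Q a n * W (Suc a) (n + 1) j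
      = Q (Suc a) n * W a (n + 1) (j + 1)"
    "Q (Suc a) (n + 1) * Q (Suc a) (n - 1) = Q (Suc a) n * Q (Suc a) n + Q (Suc (Suc a)) n * Q a n"
    "Q a n \<noteq> 0" "Q a (n + 1) \<noteq> 0" if "a \<le> r" for n j
    using W_rec[OF that, of n j] W_rec[OF that, of "n + 1" j] Suc.IH(1)[of "n + 1" "j + 1"]
      Suc.IH(2)[of n j] Q_rel[OF that, of n] Q_nonzero[of a n] Q_nonzero[of a "n + 1"] that
    by (simp_all add: add.assoc del: W.simps)
  { case 1 then show ?case using aux1[OF rels] by simp }
  { case 2 then show ?case using aux2[OF rels] by simp }
qed

text \<open>This results from eliminating \<open>W (Suc (Suc a)) (n - 1) j\<close> between the
  recursion and the first relation, both at \<open>n - 1\<close>. The identity first appears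
  multiplied by the nonzero factor \<open>Q (Suc a) (n - 2)\<close>.\<close>

lemma W_shift:
  assumes "a \<le> r"
  shows "Q (Suc a) (n - 1) * W (Suc a) n (j + 1) =
    Q a (n - 1) * W (Suc (Suc a)) n j + Q (Suc a) n * W (Suc a) (n - 1) j"
proof -
  have "q2 * (q1 * X - p * B - q0 * Y) = 0"
    if "p * A = q2 * X - q1 * Y" "q1 * A - q2 * B = s * Y" "q0 * q2 = q1 * q1 + s * p"
    for p q0 q1 q2 s A B X Y :: 'a
  proof -
    have "q2 * (q1 * X - p * B - q0 * Y)
        = q1 * (q2 * X - q1 * Y) - p * (q2 * B) + (q1 * q1 - q0 * q2) * Y"
      by (simp add: algebra_simps)
    also have "\<dots> = p * (q1 * A - q2 * B) + (q1 * q1 - q0 * q2) * Y"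
      unfolding that(1)[symmetric] by (simp add: algebra_simps)
    also have "\<dots> = 0" unfolding that(2,3) by (simp add: algebra_simps)
    finally show ?thesis .
  qed
  from this[OF _ _ Q_rel[OF assms, of "n - 1", simplified], of "W (Suc (Suc a)) (n-1) j" "W (Suc a) n (j+1)" "W (Suc a) (n - 1) j" "W (Suc (Suc a)) n j"]
  have "Q (Suc a) (n - 2) * (Q (Suc a) (n - 1) * W (Suc a) n (j + 1) -
      Q a (n - 1) * W (Suc (Suc a)) n j - Q (Suc a) n * W (Suc a) (n - 1) j) = 0"
    using W_rec[OF assms, of "n - 1" j] W_relations(1)[of "Suc a" "n - 1" j] assms
    by (simp del: W.simps)
  then show ?thesis using Q_nonzero[of "Suc a" "n - 2"] assms by (simp add: diff_eq_eq add.commute del: W.simps)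
qed

text \<open>In this range column \<open>j\<close> repeats one of the fixed columns of the
  determinant. Algebraically, the recursion propagates the zeros from size to size, except at the
  left end of the range.\<close>

lemma W_eq_0:
  assumes "a \<le> r + 1" "n - int a \<le> j" "j \<le> n - 1"
  shows "W (Suc a) n j = 0"
  using assms
proof (induction a arbitrary: n j)
  case (Suc a)
  show ?case
  proof (cases "a = 0")
    case True
    with Suc.prems have "j = n - 1" by simp
    then show ?thesis using True by (simp add: Q_def)
  next
    case False
    show ?thesis
    proof (cases "j = n - 1")
      case True
      then show ?thesis using Suc.IH[of n j] Suc.IH[of "n + 1" "j + 1"] Suc.prems False by simp
    next
      case jn: False
      show ?thesis
      proof (cases "j = n - int (Suc a)")
        \<comment> \<open>At the left end the recursion would involve \<open>W (Suc a) n j\<close>,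
          one place outside the induction hypothesis; \<open>W_shift\<close> involves only values
          inside it.\<close>
        case True
        have *: "W (Suc a) n (j + 1) = 0" using Suc.IH[of n "j + 1"] Suc.prems True False by simp
        have **: "W (Suc a) (n - 1) j = 0" using Suc.IH[of "n - 1" "j"] Suc.prems True False by simp
        show ?thesis using W_shift[of a n j] Suc.prems * ** Q_nonzero[of a "n - 1"] 
          by (simp del: W.simps)
      next
        case False
        then show ?thesis using Suc.IH[of n j] Suc.IH[of "n + 1" "j + 1"] Suc.prems jn by simp
      qed
    qed
  qed
qed simp

text \<open>At \<open>j = n\<close> the recursion for \<open>W\<close> turns into the Q-system
  relation.\<close>

lemma W_diag:
  assumes "a \<le> r + 1"
  shows "W (Suc a) n n = Q (Suc a) n"
  using assms
proof (induction a arbitrary: n)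
  case (Suc a)
  then have "Q a n * W (Suc (Suc a)) n n = Q a n * Q (Suc (Suc a)) n"
    using W_rec[of a n n] Q_rel[of a n] Suc.IH[of n] Suc.IH[of "n + 1"]
    by (simp del: W.simps add: mult.commute)
  then show ?case using Suc.prems Q_nonzero[of a n] by (simp del: W.simps)
qed (simp add: Q_def)

text \<open>This vanishing encodes the linear recurrence with constant coefficients of \<open>R\<^sub>1\<^sub>,\<^sub>n\<close>.\<close>

lemma W_top: "W (Suc (Suc r)) n j = 0"
proof -
  \<comment> \<open>In size \<open>r + 2\<close> the coefficients of the first relation are
    \<open>Q (Suc r) = 1\<close> and its right side has the factor
    \<open>Q (Suc (Suc r)) = 0\<close>. So \<open>n\<close> can be moved to \<open>j + 1\<close>,
    where \<open>W_eq_0\<close> applies.\<close>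
  have step: "W (Suc (Suc r)) n j = W (Suc (Suc r)) (n + 1) j" for n
    using W_relations(1)[of "Suc r" n j] by (simp del: W.simps)
  have "W (Suc (Suc r)) n j = W (Suc (Suc r)) (j + 1) j"
  proof (induction n rule: int_induct[where k = "j + 1"])
    case (step1 i) then show ?case using step[of i] by metis
  next
    case (step2 i) then show ?case using step[of "i - 1"] by (metis diff_add_cancel)
  qed (rule refl)
  also have "\<dots> = 0" by (rule W_eq_0) auto
  finally show ?thesis .
qed

section \<open>Triangular factorization of the Hankel matrix\<close>

lemma W_as_combination:
  assumes "a \<le> r"
  shows "\<exists>c. c a = Q a (n - 1) \<and> (\<forall>j. W (Suc a) n j = (\<Sum>l\<le>a. c l * R 1 (j + int l)))"
  using assms
proof (induction a arbitrary: n)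
  case 0
  show ?case by (rule exI[of _ "\<lambda>_. 1"]) simp
next
  case (Suc a)
  obtain c where c: "c a = Q a n" "\<And>j. W (Suc a) (n + 1) j = (\<Sum>l\<le>a. c l * R 1 (j + int l))"
    using Suc.IH[of "n + 1"] Suc.prems by auto
  obtain d where d: "d a = Q a (n - 1)" "\<And>j. W (Suc a) n j = (\<Sum>l\<le>a. d l * R 1 (j + int l))"
    using Suc.IH[of "n"] Suc.prems by auto
  define x y where "x = Q (Suc a) (n - 1) / Q a n" and "y = Q (Suc a) n / Q a n"
  \<comment> \<open>The argument \<open>j + 1\<close> in the recursion shifts the coefficients
    \<open>c\<close> by one place, so the new leading coefficient comes from \<open>c\<close>
    alone.\<close>
  define e where "e l = (if l = 0 then 0 else x * c (l - 1)) - (if l = Suc a then 0 else y * d l)" for l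
  have nz: "Q a n \<noteq> 0" using Q_nonzero Suc.prems by simp
  have "W (Suc (Suc a)) n j = (\<Sum>l\<le>Suc a. e l * R 1 (j + int l))" for j
  proof -
    have "(\<Sum>l\<le>Suc a. e l * R 1 (j + int l)) =
      (\<Sum>l\<le>Suc a. (if l = 0 then 0 else x * c (l - 1)) * R 1 (j + int l)) -
      (\<Sum>l\<le>Suc a. (if l = Suc a then 0 else y * d l) * R 1 (j + int l))"
      unfolding e_def by (simp only: left_diff_distrib sum_subtractf)
    also have "(\<Sum>l\<le>Suc a. (if l = 0 then 0 else x * c (l - 1)) * R 1 (j + int l)) =
      x * W (Suc a) (n + 1) (j + 1)"
      unfolding c(2) sum.atMost_Suc_shift by (simp add: sum_distrib_left algebra_simps)
    also have "(\<Sum>l\<le>Suc a. (if l = Suc a then 0 else y * d l) * R 1 (j + int l)) = y * W (Suc a) n j"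
      unfolding d(2) by (simp add: sum_distrib_left algebra_simps)
    finally show ?thesis by (simp add: x_def y_def diff_divide_distrib)
  qed
  moreover have "e (Suc a) = Q (Suc a) (n - 1)" using nz by (simp add: e_def x_def c(1))
  ultimately show ?case by blast
qed

text \<open>Multiplying by the upper triangular matrix \<open>L\<close> of coefficients of
  \<open>W\<close> turns the Hankel matrix into a matrix of values of \<open>W\<close>. It is lower
  triangular by \<open>W_eq_0\<close> with diagonal given by \<open>W_diag\<close>, and the quotient
  of the two determinants telescopes.\<close>

lemma hankel_det:
  assumes "k \<le> r + 1"
  shows "det (mat k k (\<lambda>(i, j). R 1 (n + int k - 1 - int i - int j))) = Q k n"
proof -
  \<comment> \<open>This is the smallest index in the matrix. With centre \<open>s + int a\<close>,
    the zeros of \<open>W (Suc a)\<close> run from \<open>s\<close> to \<open>s + int a - 1\<close>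
    for every \<open>a\<close>, which produces the triangular shape. Rows are reversed because
    entries decrease along rows and columns.\<close>
  define s where "s = n - int k + 1"
  have "\<forall>a\<in>{..r}. \<exists>c. c a = Q a (s + int a - 1) \<and>
      (\<forall>j. W (Suc a) (s + int a) j = (\<Sum>l\<le>a. c l * R 1 (j + int l)))"
    using W_as_combination by auto
  then obtain c where c: "\<And>a. a \<le> r \<Longrightarrow> c a a = Q a (s + int a - 1)"
    "\<And>a j. a \<le> r \<Longrightarrow> W (Suc a) (s + int a) j = (\<Sum>l\<le>a. c a l * R 1 (j + int l))"
    unfolding bchoice_iff by auto
  define H where "H = mat k k (\<lambda>(i, j). R 1 (n + int k - 1 - int i - int j))"
  define L where "L = mat k k (\<lambda>(i, l). if i \<le> l then c (k - 1 - i) (k - 1 - l) else 0)"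
  define U where "U = mat k k (\<lambda>(i, j). W (Suc (k - 1 - i)) (s + int (k - 1 - i)) (s + int (k - 1 - j)))"
  have carr: "L \<in> carrier_mat k k" "H \<in> carrier_mat k k" "U \<in> carrier_mat k k"
    by (auto simp: L_def H_def U_def)
  have LH: "L * H = U"
  proof (rule eq_matI)
    fix i j assume ij: "i < dim_row U" "j < dim_col U"
    then have ij: "i < k" "j < k" by (auto simp: U_def)
    have "(L * H) $$ (i, j) = (\<Sum>l<k. L $$ (i, l) * H $$ (l, j))"
      using ij carr by (simp add: scalar_prod_def atLeast0LessThan)
    also have "\<dots> = (\<Sum>l\<in>{i..<k}. c (k - 1 - i) (k - 1 - l) * R 1 (n + int k - 1 - int l - int j))"
      using ij by (intro sum.mono_neutral_cong_right) (auto simp: L_def H_def)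
    also have "\<dots> = (\<Sum>l\<le>k - 1 - i. c (k - 1 - i) l * R 1 (s + int (k - 1 - j) + int l))"
      using ij by (intro sum.reindex_bij_witness[of _ "\<lambda>l. k - 1 - l" "\<lambda>l. k - 1 - l"])
        (auto simp: s_def of_nat_diff algebra_simps)
    also have "\<dots> = U $$ (i, j)"
      using ij assms by (subst c(2)[symmetric]) (auto simp: U_def)
    finally show "(L * H) $$ (i, j) = U $$ (i, j)" .
  qed (use carr in auto)
  have "det L = (\<Prod>a<k. Q a (s + int a - 1))"
  proof -
    have "det L = prod_list (diag_mat L)"
      using carr by (intro det_upper_triangular[of _ k]) (auto simp: L_def)
    also have "\<dots> = (\<Prod>i<k. L $$ (i, i))"
      using carr by (simp add: prod_list_diag_prod atLeast0LessThan)
    also have "\<dots> = (\<Prod>i<k. Q (k - 1 - i) (s + int (k - 1 - i) - 1))"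
      using assms by (intro prod.cong refl) (simp add: L_def c(1))
    also have "\<dots> = (\<Prod>a<k. Q a (s + int a - 1))"
      by (rule prod.reindex_bij_witness[of _ "\<lambda>l. k - 1 - l" "\<lambda>l. k - 1 - l"]) auto
    finally show ?thesis .
  qed
  moreover have "det U = (\<Prod>a<k. Q (Suc a) (s + int a))"
  proof -
    have "det U = prod_list (diag_mat U)"
    proof (rule det_lower_triangular[OF _ carr(3)])
      fix i j assume ij: "i < j" "j < k"
      then have "U $$ (i, j) = W (Suc (k - 1 - i)) (s + int (k - 1 - i)) (s + int (k - 1 - j))"
        by (simp add: U_def del: W.simps)
      also have "\<dots> = 0" using ij assms by (intro W_eq_0) auto
      finally show "U $$ (i, j) = 0" .
    qed
    also have "\<dots> = (\<Prod>i<k. U $$ (i, i))"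
      using carr by (simp add: prod_list_diag_prod atLeast0LessThan)
    also have "\<dots> = (\<Prod>i<k. Q (Suc (k - 1 - i)) (s + int (k - 1 - i)))"
      using assms by (intro prod.cong refl) (simp add: U_def W_diag del: W.simps)
    also have "\<dots> = (\<Prod>a<k. Q (Suc a) (s + int a))"
      by (rule prod.reindex_bij_witness[of _ "\<lambda>l. k - 1 - l" "\<lambda>l. k - 1 - l"]) auto
    finally show ?thesis .
  qed
  moreover have "det U = det L * det H"
    using det_mult[OF carr(1,2)] LH by simp
  moreover have "(\<Prod>a<k. Q (Suc a) (s + int a)) = (\<Prod>a<k. Q a (s + int a - 1)) * Q k (s + int k - 1)"
  proof -
    have "(\<Prod>a<l. Q (Suc a) (s + int a)) = (\<Prod>a<l. Q a (s + int a - 1)) * Q l (s + int l - 1)" for l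
      by (induction l) (auto simp: algebra_simps)
    then show ?thesis .
  qed
  moreover have "(\<Prod>a<k. Q a (s + int a - 1)) \<noteq> 0"
    using assms Q_nonzero by (simp add: prod_zero_iff)
  ultimately have "det H = Q k (s + int k - 1)" by simp
  then show ?thesis by (simp add: H_def s_def)
qed

end

section \<open>The weighted count of single paths\<close>

locale motzkin_qsys = nonvanishing_qsys r R
  for r :: nat and R :: "nat \<Rightarrow> int \<Rightarrow> 'a::field" +
  fixes m :: "nat \<Rightarrow> int"
  assumes motzkin: "asc_motzkin r m"
begin

text \<open>With the boundary values chosen here, edges \<open>1\<close> and \<open>2r + 1\<close> follow the same rule as the others:
  edge \<open>2\<alpha> - 1\<close> is vertical iff \<open>M \<alpha> = M (\<alpha> - 1) + 1\<close>.\<close>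

definition M :: "nat \<Rightarrow> int" where
  "M \<alpha> = (if \<alpha> = 0 then - 1 else if \<alpha> \<le> r then m \<alpha> else m r + 1)"

lemma M_0: "M 0 = - 1" and M_1: "M (Suc 0) = 0"
  using motzkin r_pos by (auto simp: M_def asc_motzkin_def)

lemma M_Suc:
  assumes "\<alpha> \<le> r"
  shows "M (Suc \<alpha>) = (if Suc \<alpha> \<in> hset r m then M \<alpha> else M \<alpha> + 1)"
proof -
  consider "\<alpha> = 0" | "\<alpha> = r" "\<alpha> \<noteq> 0" | "\<alpha> \<in> {1..<r}" using assms by fastforce
  then show ?thesis
  proof cases
    case 3
    then have "m (\<alpha> + 1) - m \<alpha> \<in> {0, 1}" using motzkin unfolding asc_motzkin_def by blast
    then show ?thesis using 3 by (auto simp: M_def hset_def)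
  next
    case 1
    then show ?thesis by (simp add: M_0 M_1 hset_def)
  qed (auto simp: M_def hset_def)
qed

lemma M_bounds:
  assumes "1 \<le> \<alpha>" "\<alpha> \<le> r + 1" shows "0 \<le> M \<alpha>" "M \<alpha> \<le> int \<alpha> - 1"
  using assms
proof (induction \<alpha> rule: nat_induct_at_least)
  case base
  { case 1 show ?case by (simp add: M_1) }
  { case 2 show ?case by (simp add: M_1) }
next
  case (Suc n)
  { case 1 then show ?case using Suc M_Suc[of n] by auto }
  { case 2 then show ?case using Suc M_Suc[of n] by auto }
qed

lemma yw_even: 
  assumes "1 \<le> \<alpha>" "\<alpha> \<le> r"
  shows "yw m R (2 * \<alpha>) = Q (Suc \<alpha>) (M \<alpha> + 1) * Q (\<alpha> - 1) (M \<alpha>) / (Q \<alpha> (M \<alpha> + 1) * Q \<alpha> (M \<alpha>))"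
  using assms by (simp add: yw_def mu_def Q_eq M_def Let_def)

lemma lam_M:
  assumes "\<alpha> \<le> r + 1" shows "lam R \<alpha> (m \<alpha>) = Q \<alpha> (M \<alpha> + 1) / Q \<alpha> (M \<alpha>)"
proof -
  consider "\<alpha> = 0" | "\<alpha> = Suc r" | "\<alpha> \<in> {1..r}" using assms by fastforce
  then show ?thesis by cases (auto simp: lam_def Q_eq M_def qsys[unfolded qsys_def, simplified])
qed

lemma yw_odd:
  assumes "\<alpha> \<le> r"
  shows "yw m R (Suc (2 * \<alpha>)) =
    Q (Suc \<alpha>) (M (Suc \<alpha>) + 1) * Q \<alpha> (M \<alpha>) / (Q (Suc \<alpha>) (M (Suc \<alpha>)) * Q \<alpha> (M \<alpha> + 1))"
  using assms by (simp add: yw_def lam_M Let_def)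

text \<open>The divisor is the leading coefficient found in \<open>W_as_combination\<close>, so
  \<open>V\<close> corresponds to a monic polynomial. This normalization gives up steps the weight
  1.\<close>

definition V :: "nat \<Rightarrow> int \<Rightarrow> int \<Rightarrow> 'a" where
  "V \<alpha> n j = W \<alpha> n j / Q (\<alpha> - 1) (n - 1)"

text \<open>Up to the factor \<open>R\<^sub>1\<^sub>,\<^sub>0\<close>, the value \<open>T e t\<close> is the sum over paths of horizontal length
  \<open>2t - h\<close> from the upper end of edge \<open>e\<close>, at height \<open>h\<close>, down to height \<open>0\<close>.\<close>

definition T :: "nat \<Rightarrow> int \<Rightarrow> 'a" where
  "T e t = V (Suc (e div 2)) (M ((e + 1) div 2) + 1) (t - int (e div 2))"

lemma T_0: "T 0 t = R 1 t" and T_1: "T (Suc 0) t = R 1 t"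
  by (simp_all add: T_def V_def)

lemma T_horizontal:
  assumes "Suc \<alpha> \<in> hset r m"
  shows "T (Suc (2 * \<alpha>)) t = T (2 * \<alpha>) t"
proof -
  have "\<alpha> \<le> r" using assms by (auto simp: hset_def)
  then show ?thesis using assms by (simp add: T_def M_Suc)
qed

lemma T_top: "T (Suc (Suc (2 * r))) t = 0"
  by (simp add: T_def V_def W_top del: W.simps)

text \<open>This is \<open>W_shift\<close> after normalization: crossing a vertical odd edge lowers
  the centre by one.\<close>

lemma T_odd_rec:
  assumes "\<alpha> \<le> r" "Suc \<alpha> \<notin> hset r m"
  shows "T (Suc (2 * \<alpha>)) t = T (Suc (Suc (2 * \<alpha>))) t + yw m R (Suc (2 * \<alpha>)) * T (2 * \<alpha>) (t - 1)"
proof -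
  define n where "n = M (Suc \<alpha>) + 1"
  have n: "M \<alpha> = n - 2" "M (Suc \<alpha>) = n - 1" using M_Suc[of \<alpha>] assms by (auto simp: n_def)
  define j where "j = t - 1 - int \<alpha>"
  have nz: "Q (Suc \<alpha>) (n - 1) \<noteq> 0" "Q \<alpha> (n - 1) \<noteq> 0" "Q \<alpha> (n - 2) \<noteq> 0" using assms by (auto simp: Q_nonzero)
  have "W (Suc \<alpha>) n (j + 1) = (Q \<alpha> (n - 1) * W (Suc (Suc \<alpha>)) n j + Q (Suc \<alpha>) n * W (Suc \<alpha>) (n - 1) j) / Q (Suc \<alpha>) (n - 1)"
    using W_shift[of \<alpha> n j] assms nz by (simp add: field_simps del: W.simps)
  then have "V (Suc \<alpha>) n (j + 1) = V (Suc (Suc \<alpha>)) n j + Q (Suc \<alpha>) n * Q \<alpha> (n - 2) / (Q (Suc \<alpha>) (n - 1) * Q \<alpha> (n - 1)) * V (Suc \<alpha>) (n - 1) j"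
    unfolding V_def using nz by (simp add: field_simps del: W.simps)
  then show ?thesis
    using yw_odd[OF assms(1)] by (simp add: T_def n j_def algebra_simps)
qed

lemma V_diff:
  assumes "1 \<le> \<alpha>" "\<alpha> \<le> r"
  shows "V (Suc \<alpha>) (M \<alpha> + 1) j = V (Suc \<alpha>) (M \<alpha> + 2) j + yw m R (2 * \<alpha>) * V \<alpha> (M \<alpha> + 1) j"
proof -
  define n where "n = M \<alpha> + 1"
  have n: "M \<alpha> = n - 1" by (simp add: n_def)
  have nz: "Q \<alpha> n \<noteq> 0" "Q \<alpha> (n - 1) \<noteq> 0" "Q (\<alpha> - 1) (n - 1) \<noteq> 0" using assms by (auto simp: Q_nonzero)
  have "W (Suc \<alpha>) n j = (Q \<alpha> (n - 1) * W (Suc \<alpha>) (n + 1) j + Q (Suc \<alpha>) n * W \<alpha> n j) / Q \<alpha> n"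
    using W_relations(1)[of \<alpha> n j] assms nz by (simp add: field_simps del: W.simps)
  then have "V (Suc \<alpha>) n j = V (Suc \<alpha>) (n + 1) j + Q (Suc \<alpha>) n * Q (\<alpha> - 1) (n - 1) / (Q \<alpha> n * Q \<alpha> (n - 1)) * V \<alpha> n j"
    unfolding V_def using nz by (simp add: field_simps del: W.simps)
  then show ?thesis using yw_even[OF assms] by (simp add: n add.commute)
qed

lemma T_even_vertical_rec:
  assumes "1 \<le> \<alpha>" "\<alpha> \<le> r" "Suc \<alpha> \<notin> hset r m"
  shows "T (2 * \<alpha>) t = T (Suc (2 * \<alpha>)) t + yw m R (2 * \<alpha>) * T (2 * \<alpha> - 1) (t - 1)"
proof -
  have "(2 * \<alpha> - 1) div 2 = \<alpha> - 1" "Suc (2 * \<alpha> - 1) = 2 * \<alpha>" using assms by auto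
  then show ?thesis
    using V_diff[of \<alpha> "t - int \<alpha>"] M_Suc[of \<alpha>] assms
    by (simp add: T_def of_nat_diff algebra_simps)
qed

text \<open>Here \<open>V_diff\<close> leads to size \<open>Suc \<alpha>\<close> with centre
  \<open>M \<alpha> + 2\<close>, which belongs to no vertex of the tree. The recursion for
  \<open>W\<close> resolves this value into the up step over edge \<open>2 * \<alpha> + 2\<close>
  and the horizontal step.\<close>

lemma T_even_horizontal_rec:
  assumes "1 \<le> \<alpha>" "\<alpha> \<le> r" "Suc \<alpha> \<in> hset r m"
  shows "T (2 * \<alpha>) t = T (Suc (Suc (2 * \<alpha>))) t + yw m R (2 * \<alpha>) * T (2 * \<alpha> - 1) (t - 1)
    + yw m R (Suc (2 * \<alpha>)) * T (2 * \<alpha>) (t - 1)"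
proof -
  define n where "n = M \<alpha> + 1"
  have n: "M \<alpha> = n - 1" "M (Suc \<alpha>) = n - 1" using M_Suc[of \<alpha>] assms by (auto simp: n_def)
  define j where "j = t - 1 - int \<alpha>"
  have nz: "Q (Suc \<alpha>) (n - 1) \<noteq> 0" "Q \<alpha> (n - 1) \<noteq> 0" "Q \<alpha> n \<noteq> 0" using assms by (auto simp: Q_nonzero)
  have "W (Suc \<alpha>) (n + 1) (j + 1) = (Q \<alpha> n * W (Suc (Suc \<alpha>)) n j + Q (Suc \<alpha>) n * W (Suc \<alpha>) n j) / Q (Suc \<alpha>) (n - 1)"
    using W_rec[of \<alpha> n j] assms nz by (simp add: field_simps del: W.simps)
  then have "V (Suc \<alpha>) (n + 1) (j + 1) = V (Suc (Suc \<alpha>)) n j + Q (Suc \<alpha>) n * Q \<alpha> (n - 1) / (Q (Suc \<alpha>) (n - 1) * Q \<alpha> n) * V (Suc \<alpha>) n j"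
    unfolding V_def using nz by (simp add: field_simps del: W.simps)
  then have "V (Suc \<alpha>) (n + 1) (j + 1) = T (Suc (Suc (2 * \<alpha>))) t + yw m R (Suc (2 * \<alpha>)) * T (2 * \<alpha>) (t - 1)"
    using yw_odd[OF assms(2)] by (simp add: T_def n j_def algebra_simps)
  moreover have "(2 * \<alpha> - 1) div 2 = \<alpha> - 1" "Suc (2 * \<alpha> - 1) = 2 * \<alpha>" using assms by auto
  ultimately show ?thesis
    using V_diff[of \<alpha> "j + 1"] assms
    by (simp add: T_def n j_def of_nat_diff algebra_simps)
qed

section \<open>Heights and edges of the tree\<close>

lemma vertical_even: "1 \<le> \<alpha> \<Longrightarrow> \<alpha> \<le> r \<Longrightarrow> vertical r m (2 * \<alpha>)"
  by (simp add: vertical_def)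

lemma vertical_odd: "\<alpha> \<le> r \<Longrightarrow> vertical r m (Suc (2 * \<alpha>)) \<longleftrightarrow> Suc \<alpha> \<notin> hset r m"
  by (simp add: vertical_def)

lemma vpos_0 [simp]: "vpos r m 0 = 0"
  by (simp add: vpos_def)

lemma vpos_Suc: "vpos r m (Suc e) = vpos r m e + (if vertical r m (Suc e) then 1 else 0)"
proof -
  have "{e' \<in> {1..Suc e}. vertical r m e'} =
    (if vertical r m (Suc e) then insert (Suc e) {e' \<in> {1..e}. vertical r m e'} else {e' \<in> {1..e}. vertical r m e'})"
    by (auto simp: le_Suc_eq)
  then show ?thesis by (simp add: vpos_def)
qed

text \<open>Every even edge is vertical, and \<open>M\<close> grows by one at exactly the vertical
  odd edges; the summand 1 compensates \<open>M 0 = - 1\<close>.\<close>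

lemma vpos_formula:
  assumes "e \<le> Suc (2 * r)"
  shows "int (vpos r m e) = int (e div 2) + 1 + M ((e + 1) div 2)"
  using assms
proof (induction e)
  case (Suc e)
  show ?case
  proof (cases "even e")
    case True
    then obtain \<alpha> where "e = 2 * \<alpha>" by blast
    then show ?thesis using Suc M_Suc[of \<alpha>] vertical_odd[of \<alpha>] by (auto simp: vpos_Suc)
  next
    case False
    then obtain \<alpha> where "e = 2 * \<alpha> + 1" by (rule oddE)
    then show ?thesis using Suc vertical_even[of "Suc \<alpha>"] by (auto simp: vpos_Suc)
  qed
qed (simp add: M_0)

lemma vpos_mono: "e \<le> e' \<Longrightarrow> vpos r m e \<le> vpos r m e'"
  by (induction e' rule: dec_induct) (auto simp: vpos_Suc)

lemma vpos_strict: 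
  assumes "e < e'" "vertical r m e'" shows "vpos r m e < vpos r m e'"
proof -
  obtain e'' where "e' = Suc e''" "e \<le> e''" using assms by (cases e') auto
  then show ?thesis using assms vpos_mono[of e e''] by (simp add: vpos_Suc)
qed

lemma vpos_inj:
  assumes "vertical r m e" "vertical r m e'" "vpos r m e = vpos r m e'" shows "e = e'"
  using vpos_strict[of e e'] vpos_strict[of e' e] assms by (cases e e' rule: linorder_cases) auto

lemma vpos_pos:
  assumes "1 \<le> e" shows "1 \<le> vpos r m e"
proof -
  have "vpos r m (Suc 0) = 1" by (simp add: vpos_Suc vertical_def hset_def)
  then show ?thesis using vpos_mono[of 1 e] assms by simp
qed

lemma NN_eq: "NN r m = vpos r m (Suc (2 * r))"
proof -
  have sub: "hset r m \<subseteq> {2..r}" by (auto simp: hset_def)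
  have "{e' \<in> {1..Suc (2 * r)}. vertical r m e'} = {1..Suc (2 * r)} - (\<lambda>\<alpha>. 2 * \<alpha> - 1) ` hset r m"
  proof (intro Set.set_eqI iffI)
    fix e assume "e \<in> {e' \<in> {1..Suc (2 * r)}. vertical r m e'}"
    then have e: "e \<in> {1..Suc (2 * r)}" and v: "vertical r m e" by auto
    have False if "\<alpha> \<in> hset r m" "e = 2 * \<alpha> - 1" for \<alpha>
    proof -
      have "1 \<le> \<alpha>" using that sub by auto
      then have "odd e" "(e + 1) div 2 = \<alpha>" using that(2) by auto
      then show False using v that(1) by (simp add: vertical_def)
    qed
    with e show "e \<in> {1..Suc (2 * r)} - (\<lambda>\<alpha>. 2 * \<alpha> - 1) ` hset r m" by blast
  next
    fix e assume e: "e \<in> {1..Suc (2 * r)} - (\<lambda>\<alpha>. 2 * \<alpha> - 1) ` hset r m"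
    have "\<not> (odd e \<and> (e + 1) div 2 \<in> hset r m)"
    proof
      assume A: "odd e \<and> (e + 1) div 2 \<in> hset r m"
      then have "e = 2 * ((e + 1) div 2) - 1" by (auto elim!: oddE)
      with A e show False by blast
    qed
    with e show "e \<in> {e' \<in> {1..Suc (2 * r)}. vertical r m e'}" by (simp add: vertical_def)
  qed
  moreover have "card ((\<lambda>\<alpha>. 2 * \<alpha> - 1) ` hset r m) = card (hset r m)"
    using sub by (intro card_image inj_onI) fastforce
  moreover have "(\<lambda>\<alpha>. 2 * \<alpha> - 1) ` hset r m \<subseteq> {1..Suc (2 * r)}"
    using sub by fastforce
  ultimately show ?thesis
    by (simp add: NN_def vpos_def card_Diff_subset finite_subset[OF sub])
qed

lemma down_wt_vpos:
  assumes "vertical r m e" shows "down_wt r m R (int (vpos r m e)) = yw m R e"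
proof -
  have "(THE e'. vertical r m e' \<and> int (vpos r m e') = int (vpos r m e)) = e"
    using assms vpos_inj by (intro the_equality) auto
  then show ?thesis by (simp add: down_wt_def)
qed

lemma hset_vertical: "\<alpha> \<in> hset r m \<Longrightarrow> vertical r m (2 * \<alpha> - 2)"
  using vertical_even[of "\<alpha> - 1"] by (auto simp: hset_def diff_mult_distrib2)

lemma has_horiz_0: "\<not> has_horiz r m 0"
proof
  assume "has_horiz r m 0"
  then obtain \<alpha> where "\<alpha> \<in> hset r m" "vpos r m (2 * \<alpha> - 2) = 0" by (auto simp: has_horiz_def)
  moreover from this have "2 \<le> \<alpha>" by (simp add: hset_def)
  then have "1 \<le> 2 * \<alpha> - 2" by arith
  ultimately show False using vpos_pos[of "2 * \<alpha> - 2"] by simp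
qed

lemma has_horiz_odd:
  assumes "vertical r m (Suc (2 * \<alpha>))" shows "\<not> has_horiz r m (int (vpos r m (Suc (2 * \<alpha>))))"
proof
  assume "has_horiz r m (int (vpos r m (Suc (2 * \<alpha>))))"
  then obtain \<beta> where "\<beta> \<in> hset r m" "vpos r m (2 * \<beta> - 2) = vpos r m (Suc (2 * \<alpha>))"
    by (auto simp: has_horiz_def)
  then have "2 * \<beta> - 2 = Suc (2 * \<alpha>)" using vpos_inj hset_vertical assms by blast
  then show False by presburger
qed

lemma horiz_even:
  assumes "1 \<le> \<alpha>" "\<alpha> \<le> r"
  shows has_horiz_even: "has_horiz r m (int (vpos r m (2 * \<alpha>))) \<longleftrightarrow> Suc \<alpha> \<in> hset r m"
    and horiz_wt_even: "Suc \<alpha> \<in> hset r m \<Longrightarrow> horiz_wt r m R (int (vpos r m (2 * \<alpha>))) = yw m R (Suc (2 * \<alpha>))"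
proof -
  have uniq: "\<beta> = Suc \<alpha>" if "\<beta> \<in> hset r m" "vpos r m (2 * \<beta> - 2) = vpos r m (2 * \<alpha>)" for \<beta>
  proof -
    have "2 * \<beta> - 2 = 2 * \<alpha>"
      using vpos_inj[OF hset_vertical[OF that(1)] vertical_even[OF assms] that(2)] .
    then show ?thesis using that by (auto simp: hset_def)
  qed
  show "has_horiz r m (int (vpos r m (2 * \<alpha>))) \<longleftrightarrow> Suc \<alpha> \<in> hset r m"
  proof
    assume "has_horiz r m (int (vpos r m (2 * \<alpha>)))"
    then obtain \<beta> where \<beta>: "\<beta> \<in> hset r m" "vpos r m (2 * \<beta> - 2) = vpos r m (2 * \<alpha>)"
      unfolding has_horiz_def by auto
    then show "Suc \<alpha> \<in> hset r m" using uniq[OF \<beta>] by simp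
  next
    assume "Suc \<alpha> \<in> hset r m"
    then show "has_horiz r m (int (vpos r m (2 * \<alpha>)))"
      unfolding has_horiz_def by (rule bexI[rotated]) simp
  qed
  assume H: "Suc \<alpha> \<in> hset r m"
  have "(THE \<beta>. \<beta> \<in> hset r m \<and> int (vpos r m (2 * \<beta> - 2)) = int (vpos r m (2 * \<alpha>))) = Suc \<alpha>"
  proof (rule the_equality)
    show "\<beta> = Suc \<alpha>" if "\<beta> \<in> hset r m \<and> int (vpos r m (2 * \<beta> - 2)) = int (vpos r m (2 * \<alpha>))" for \<beta>
      by (rule uniq) (use that in simp_all)
  qed (use H in simp)
  then show "horiz_wt r m R (int (vpos r m (2 * \<alpha>))) = yw m R (Suc (2 * \<alpha>))"
    by (simp add: horiz_wt_def)
qed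

section \<open>Path sums down to height 0\<close>

definition lstep :: "int \<times> int \<Rightarrow> int \<times> int \<Rightarrow> bool" where
  "lstep p q \<longleftrightarrow> snd p \<in> {0..int (NN r m)} \<and> snd q \<in> {0..int (NN r m)} \<and> step_ok r m p q"

lemma lstep_iff:
  assumes "0 \<le> h" "h \<le> int (NN r m)"
  shows "lstep (x, h) q \<longleftrightarrow> q = (x + 1, h + 1) \<and> h < int (NN r m) \<or> q = (x + 1, h - 1) \<and> 1 \<le> h
    \<or> q = (x + 2, h) \<and> has_horiz r m h"
  using assms by (cases q) (auto simp: lstep_def step_ok_def)

sublocale ranked_steps lstep fst
proof
  show "fst p < fst q" if "lstep p q" for p q
    using that by (auto simp: lstep_def step_ok_def)
  show "finite {q. lstep p q}" for p
    by (rule finite_subset[of _ "{(fst p + 1, snd p + 1), (fst p + 1, snd p - 1), (fst p + 2, snd p)}"])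
      (auto simp: lstep_def step_ok_def)
qed

abbreviation psum :: "int \<times> int \<Rightarrow> int \<times> int \<Rightarrow> 'a" where
  "psum \<equiv> path_sum lstep (step_wt r m R)"

lemma psum_unfold:
  assumes "0 \<le> h" "h \<le> int (NN r m)"
  shows "psum (x, h) E = (if (x, h) = E then 1 else 0)
    + (if h < int (NN r m) then psum (x + 1, h + 1) E else 0)
    + (if 1 \<le> h then down_wt r m R h * psum (x + 1, h - 1) E else 0)
    + (if has_horiz r m h then horiz_wt r m R h * psum (x + 2, h) E else 0)"
proof -
  have "{q. lstep (x, h) q} = (if h < int (NN r m) then {(x + 1, h + 1)} else {}) \<union>
      (if 1 \<le> h then {(x + 1, h - 1)} else {}) \<union> (if has_horiz r m h then {(x + 2, h)} else {})"
    by (auto simp: lstep_iff[OF assms])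
  then show ?thesis
    by (subst path_sum_unfold) (auto simp: step_wt_def)
qed

lemma vpos_le_NN: "e \<le> Suc (2 * r) \<Longrightarrow> vpos r m e \<le> NN r m"
  by (simp add: NN_eq vpos_mono)

lemma vpos_less_NN: 
  assumes "e \<le> 2 * r" shows "vpos r m e < NN r m"
proof -
  have "vertical r m (Suc (2 * r))" by (auto simp: vertical_def hset_def)
  then show ?thesis using assms vpos_strict[of e "Suc (2 * r)"] by (simp add: NN_eq)
qed

text \<open>Boundary value for \<open>psum_eq_T\<close>: no path of length 0 descends from a
  positive height. The argument falls among the zeros of \<open>W\<close> by
  \<open>M_bounds\<close>; for odd \<open>e\<close> the extreme case
  \<open>M \<mu> = int \<mu> - 1\<close> is excluded by parity, as \<open>vpos\<close> would be
  odd.\<close>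

lemma T_start:
  assumes "1 \<le> e" "e \<le> Suc (2 * r)" "2 * t = int (vpos r m e)"
  shows "T e t = 0"
proof -
  define \<mu> where "\<mu> = (e + 1) div 2"
  have \<mu>: "1 \<le> \<mu>" "\<mu> \<le> r + 1" using assms by (auto simp: \<mu>_def)
  have e: "e = 2 * \<mu> \<or> e = 2 * \<mu> - 1" unfolding \<mu>_def using assms by presburger
  have d: "int (e div 2) = (if e = 2 * \<mu> then int \<mu> else int \<mu> - 1)" using e \<mu> by (auto simp: of_nat_diff)
  have v: "2 * t = int (e div 2) + 1 + M \<mu>"
    using vpos_formula[of e] assms by (simp add: \<mu>_def)
  have "W (Suc (e div 2)) (M \<mu> + 1) (t - int (e div 2)) = 0"
    using assms M_bounds[of \<mu>] \<mu> v d by (intro W_eq_0) (auto split: if_splits)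
  then show ?thesis by (simp add: T_def V_def \<mu>_def)
qed

text \<open>Boundary value for remaining length -1, reached when a horizontal step of length 2
  overshoots the end by one.\<close>

lemma T_before_start:
  assumes "1 \<le> \<alpha>" "\<alpha> \<le> r" "2 * t = int (vpos r m (2 * \<alpha>)) - 1"
  shows "T (2 * \<alpha>) t = 0"
proof -
  have v: "2 * t = int \<alpha> + M \<alpha>"
    using vpos_formula[of "2 * \<alpha>"] assms by simp
  have "W (Suc \<alpha>) (M \<alpha> + 1) (t - int \<alpha>) = 0"
    using assms M_bounds[of \<alpha>] v by (intro W_eq_0) auto
  then show ?thesis by (simp add: T_def V_def)
qed

text \<open>Both sides obey the same first-step recursion, with the same boundary values; the
  induction is on the remaining horizontal length.\<close>

lemma psum_eq_T:
  assumes "e \<le> Suc (2 * r)" "X - x = 2 * t - int (vpos r m e)" "x \<le> X"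
  shows "R 1 0 * psum (x, int (vpos r m e)) (X, 0) = T e t"
  using assms
proof (induction "nat (X - x)" arbitrary: x e t rule: less_induct)
  case less
  have IH: "R 1 0 * psum (x', int (vpos r m e')) (X, 0) = T e' t'"
    if "x < x'" "e' \<le> Suc (2 * r)" "X - x' = 2 * t' - int (vpos r m e')" "x' \<le> X" for x' e' t'
    using that less by auto
  \<comment> \<open>Each chain vertex is represented first by its root or vertical edge. A
    horizontal edge has the same \<open>vpos\<close> and \<open>T\<close> as the even edge before it
    and is reduced to that edge at the end.\<close>
  have main: "R 1 0 * psum (x, int (vpos r m e)) (X, 0) = T e t"
    if e: "e = 0 \<or> vertical r m e" and "e \<le> Suc (2 * r)" "X - x = 2 * t - int (vpos r m e)" for e t
  proof (cases "x = X")
    note prems = that(2,3) less.prems(3)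
    case True
    have z: "psum (x + 1, h) (X, 0) = 0" "psum (x + 2, h) (X, 0) = 0" for h
      using True by (auto intro: path_sum_eq_0)
    have "psum (x, int (vpos r m e)) (X, 0) = (if e = 0 then 1 else 0)"
      using psum_unfold[of "int (vpos r m e)" x "(X, 0)"] z True vpos_le_NN[OF that(2)] vpos_pos[of e]
      by (cases "e = 0") (auto simp: Suc_le_eq)
    then show ?thesis using prems True T_start[of e t] by (auto simp: T_0 Suc_le_eq)
  next
    note prems = that(2,3) less.prems(3)
    case False
    then have xX: "x + 1 \<le> X" using prems by simp
    have le: "vpos r m e \<le> NN r m" using vpos_le_NN prems by simp
    consider "e = 0" | \<alpha> where "e = 2 * \<alpha>" "1 \<le> \<alpha>" "\<alpha> \<le> r" "Suc \<alpha> \<notin> hset r m"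
      | \<alpha> where "e = 2 * \<alpha>" "1 \<le> \<alpha>" "\<alpha> \<le> r" "Suc \<alpha> \<in> hset r m"
      | \<alpha> where "e = Suc (2 * \<alpha>)" "\<alpha> < r" "Suc \<alpha> \<notin> hset r m" | "e = Suc (2 * r)"
    proof (cases "even e")
      case True
      then obtain \<alpha> where "e = 2 * \<alpha>" by blast
      then show ?thesis using that(1,2,3) prems by (cases "\<alpha> = 0") auto
    next
      case False
      then obtain \<alpha> where \<alpha>: "e = 2 * \<alpha> + 1" by (rule oddE)
      then have "\<alpha> \<le> r" using prems by simp
      then show ?thesis using that(4)[of \<alpha>] that(5) e \<alpha> vertical_odd[of \<alpha>] by (cases "\<alpha> = r") auto
    qed
    then show ?thesis
    proof cases
      case 1
      \<comment> \<open>Only an up step leaves the root, and \<open>T 0\<close> and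
        \<open>T 1\<close> coincide.\<close>
      have "psum (x, 0) (X, 0) = psum (x + 1, 1) (X, 0)"
        using psum_unfold[of 0 x "(X, 0)"] False has_horiz_0 vpos_less_NN[of 0] by simp
      moreover have v1: "vpos r m (Suc 0) = 1" by (simp add: vpos_Suc vertical_def hset_def)
      ultimately show ?thesis
        using IH[of "x + 1" 1 t] xX prems 1 by (simp add: T_0 T_1)
    next
      case (2 \<alpha>)
      note v = vertical_even[OF 2(2,3)]
      have up: "vpos r m (Suc e) = vpos r m e + 1"
        using 2 vertical_odd[of \<alpha>] by (simp add: vpos_Suc)
      have "Suc (e - 1) = e" using 2 by simp
      then have dn: "vpos r m e = vpos r m (e - 1) + 1"
        using vpos_Suc[of "e - 1"] v 2(1) by simp
      have "psum (x, int (vpos r m e)) (X, 0) = psum (x + 1, int (vpos r m (Suc e))) (X, 0)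
          + yw m R e * psum (x + 1, int (vpos r m (e - 1))) (X, 0)"
        using psum_unfold[of "int (vpos r m e)" x "(X, 0)"] False le has_horiz_even[OF 2(2,3)] 2
          vpos_less_NN[of e] up dn down_wt_vpos[OF v] by (simp add: add.commute)
      moreover have "R 1 0 * psum (x + 1, int (vpos r m (Suc e))) (X, 0) = T (Suc e) t"
        using xX prems up 2 by (intro IH) auto
      moreover have "R 1 0 * psum (x + 1, int (vpos r m (e - 1))) (X, 0) = T (e - 1) (t - 1)"
        using xX prems dn 2 by (intro IH) auto
      ultimately show ?thesis
        using T_even_vertical_rec[OF 2(2-4), of t] 2(1) by (simp add: distrib_left mult.left_commute)
    next
      case (3 \<alpha>)
      note v = vertical_even[OF 3(2,3)]
      have r: "Suc \<alpha> \<le> r" using 3(4) by (auto simp: hset_def)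
      \<comment> \<open>Edge \<open>Suc e\<close> is horizontal, so the next higher vertex is the
        upper end of edge \<open>Suc (Suc e)\<close>.\<close>
      have up: "vpos r m (Suc (Suc e)) = vpos r m e + 1"
        using 3 r vertical_odd[of \<alpha>] vertical_even[of "Suc \<alpha>"] by (simp add: vpos_Suc)
      have "Suc (e - 1) = e" using 3 by simp
      then have dn: "vpos r m e = vpos r m (e - 1) + 1"
        using vpos_Suc[of "e - 1"] v 3(1) by simp
      have "psum (x, int (vpos r m e)) (X, 0) = psum (x + 1, int (vpos r m (Suc (Suc e)))) (X, 0)
          + yw m R e * psum (x + 1, int (vpos r m (e - 1))) (X, 0)
          + yw m R (Suc e) * psum (x + 2, int (vpos r m e)) (X, 0)"
        using psum_unfold[of "int (vpos r m e)" x "(X, 0)"] False le has_horiz_even[OF 3(2,3)] 3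
          vpos_less_NN[of e] up dn down_wt_vpos[OF v] horiz_wt_even[OF 3(2-4)] by (simp add: add.commute)
      moreover have "R 1 0 * psum (x + 1, int (vpos r m (Suc (Suc e)))) (X, 0) = T (Suc (Suc e)) t"
        using xX prems up 3 r by (intro IH) auto
      moreover have "R 1 0 * psum (x + 1, int (vpos r m (e - 1))) (X, 0) = T (e - 1) (t - 1)"
        using xX prems dn 3 by (intro IH) auto
      moreover have "R 1 0 * psum (x + 2, int (vpos r m e)) (X, 0) = T e (t - 1)"
      proof (cases "x + 2 \<le> X")
        case True
        then show ?thesis using prems by (intro IH) auto
      next
        case False
        then have "psum (x + 2, int (vpos r m e)) (X, 0) = 0" by (intro path_sum_eq_0) simp
        moreover have "T e (t - 1) = 0"
          unfolding 3(1) using False xX prems 3 by (intro T_before_start) auto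
        ultimately show ?thesis by simp
      qed
      ultimately show ?thesis
        using T_even_horizontal_rec[OF 3(2-4), of t] 3(1)
        by (simp only: distrib_left mult.left_commute[of "R 1 0"])
    next
      case (4 \<alpha>)
      have v: "vertical r m e" using 4 vertical_odd[of \<alpha>] by simp
      have up: "vpos r m (Suc e) = vpos r m e + 1"
        using 4 vertical_even[of "Suc \<alpha>"] by (simp add: vpos_Suc[of "Suc (2 * \<alpha>)"])
      have dn: "vpos r m e = vpos r m (2 * \<alpha>) + 1"
        using vpos_Suc[of "2 * \<alpha>"] v 4(1) by simp
      have "psum (x, int (vpos r m e)) (X, 0) = psum (x + 1, int (vpos r m (Suc e))) (X, 0)
          + yw m R e * psum (x + 1, int (vpos r m (2 * \<alpha>))) (X, 0)"
        using psum_unfold[of "int (vpos r m e)" x "(X, 0)"] False le has_horiz_odd[of \<alpha>] 4(1,2) v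
          vpos_less_NN[of e] up dn down_wt_vpos[OF v] by (simp add: add.commute)
      moreover have "R 1 0 * psum (x + 1, int (vpos r m (Suc e))) (X, 0) = T (Suc e) t"
        using xX prems up 4 by (intro IH) auto
      moreover have "R 1 0 * psum (x + 1, int (vpos r m (2 * \<alpha>))) (X, 0) = T (2 * \<alpha>) (t - 1)"
        using xX prems dn 4 by (intro IH) auto
      ultimately show ?thesis
        using T_odd_rec[of \<alpha> t] 4 by (simp add: distrib_left mult.left_commute)
    next
      case 5
      have h: "Suc r \<notin> hset r m" by (auto simp: hset_def)
      have v: "vertical r m e" using 5 h vertical_odd[of r] by simp
      have dn: "vpos r m e = vpos r m (2 * r) + 1"
        using vpos_Suc[of "2 * r"] v 5 by simp
      \<comment> \<open>At the top there is no up step, matching the vanishing of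
        \<open>T_top\<close> in the recursion.\<close>
      have "psum (x, int (vpos r m e)) (X, 0) = yw m R e * psum (x + 1, int (vpos r m (2 * r))) (X, 0)"
        using psum_unfold[of "int (vpos r m e)" x "(X, 0)"] False le has_horiz_odd[of r] 5 v
          NN_eq dn down_wt_vpos[OF v] by (simp add: add.commute)
      moreover have "R 1 0 * psum (x + 1, int (vpos r m (2 * r))) (X, 0) = T (2 * r) (t - 1)"
        using xX prems dn 5 by (intro IH) auto
      ultimately show ?thesis
        using T_odd_rec[of r t] 5 h T_top by (simp add: mult.left_commute)
    qed
  qed
  show ?case
  proof (cases "e = 0 \<or> vertical r m e")
    case True
    then show ?thesis using less.prems by (intro main) auto
  next
    case False
    have "odd e"
    proof
      assume "even e"
      then obtain \<alpha> where "e = 2 * \<alpha>" by blast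
      then show False using False less.prems vertical_even[of \<alpha>] by auto
    qed
    then obtain \<alpha> where \<alpha>: "e = Suc (2 * \<alpha>)" by (auto elim: oddE)
    then have H: "Suc \<alpha> \<in> hset r m" using False less.prems vertical_odd[of \<alpha>] by auto
    have "vpos r m e = vpos r m (2 * \<alpha>)"
      using False \<alpha> by (simp add: vpos_Suc)
    moreover have "2 * \<alpha> = 0 \<or> vertical r m (2 * \<alpha>)"
      using \<alpha> less.prems vertical_even[of \<alpha>] by (cases "\<alpha> = 0") auto
    ultimately show ?thesis
      using main[of "2 * \<alpha>" t] less.prems T_horizontal[OF H, of t] \<alpha> by simp
  qed
qed

end

section \<open>Planarity and disjoint families\<close>

text \<open>Holding the height until the next vertex defines it also halfway through a horizontal
  step, so two paths can be compared at every integer abscissa.\<close>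

fun height_at :: "(int \<times> int) list \<Rightarrow> int \<Rightarrow> int" where
  "height_at [] x = 0"
| "height_at [p] x = snd p"
| "height_at (p # q # P) x = (if x < fst q then snd p else height_at (q # P) x)"

context motzkin_qsys
begin

lemma height_at_start:
  assumes "P \<in> paths lstep (a, h) E" shows "height_at P a = h"
proof -
  obtain P' where P: "P = (a, h) # P'" using assms by (cases P) (auto simp: paths_def)
  show ?thesis
  proof (cases P')
    case (Cons q P'')
    then have "lstep (a, h) q" using assms P by (simp add: paths_def)
    then show ?thesis using rank_step P Cons by fastforce
  qed (simp add: P)
qed

lemma height_at_end:
  assumes "P \<in> paths lstep A (b, h)" shows "height_at P b = h"
  using assms
proof (induction P arbitrary: A rule: induct_list012)
  case (3 p q P)
  then have q: "q # P \<in> paths lstep q (b, h)" by (auto simp: paths_def)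
  then show ?case using 3(2)[OF q] rank_le_if_paths[OF q] by simp
qed (auto simp: paths_def)

text \<open>In the odd case \<open>x\<close> is the abscissa of the midpoint of a horizontal step.\<close>

lemma height_at_cases:
  assumes "P \<in> paths lstep (a, h) (b, h')" "even (a + h)" "0 \<le> h" "a \<le> x" "x \<le> b"
  shows "0 \<le> height_at P x"
    and "even (x + height_at P x) \<and> (x, height_at P x) \<in> set P \<or>
      odd (x + height_at P x) \<and> x < b \<and> (x - 1, height_at P x) \<in> set P \<and> height_at P (x + 1) = height_at P x"
      (is "?C P x")
    and "x < b \<longrightarrow> \<bar>height_at P (x + 1) - height_at P x\<bar> \<le> 1"
proof -
  have "0 \<le> height_at P x \<and> ?C P x \<and> (x < b \<longrightarrow> \<bar>height_at P (x + 1) - height_at P x\<bar> \<le> 1)"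
    using assms
  proof (induction P arbitrary: a h rule: induct_list012)
    case (2 p)
    then show ?case by (auto simp: paths_def)
  next
    case (3 p q P)
    obtain a' h'' where q: "q = (a', h'')" by (cases q)
    have p: "p = (a, h)" and st: "lstep (a, h) (a', h'')" and
      qP: "q # P \<in> paths lstep (a', h'') (b, h')" using 3(3) by (auto simp: paths_def q)
    have a'b: "a' \<le> b" using rank_le_if_paths[OF qP] by simp
    have start: "height_at (q # P) a' = h''" using height_at_start[OF qP] .
    have cases: "a' = a + 1 \<and> (h'' = h + 1 \<or> h'' = h - 1) \<or> a' = a + 2 \<and> h'' = h" and nn: "0 \<le> h''"
      using st by (auto simp: lstep_def step_ok_def)
    show ?case
    proof (cases "x < a'")
      case True
      have hx: "height_at (p # q # P) x = h" using True by (simp add: p q)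
      consider "x = a" "a' = a + 1" "h'' = h + 1 \<or> h'' = h - 1" | "x = a" "a' = a + 2" "h'' = h"
        | "x = a + 1" "a' = a + 2" "h'' = h"
        using cases True 3(6) by linarith
      then show ?thesis
      proof cases
        case 1
        then have "height_at (p # q # P) (x + 1) = h''" using start by (simp add: q)
        then show ?thesis unfolding hx using 1 3(4,5) p a'b by auto
      next
        case 2
        then have "height_at (p # q # P) (x + 1) = h" by (simp add: p q)
        then show ?thesis unfolding hx using 2 3(4,5) p a'b by auto
      next
        case 3
        then have "height_at (p # q # P) (x + 1) = h" using start by (simp add: q add.commute)
        then show ?thesis unfolding hx using 3 \<open>even (a + h)\<close> \<open>0 \<le> h\<close> p a'b by auto
      qed
    next
      case False
      then have "height_at (p # q # P) x = height_at (q # P) x"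
        "height_at (p # q # P) (x + 1) = height_at (q # P) (x + 1)" by (auto simp: q)
      moreover have "even (a' + h'')" using cases 3(4) by auto
      ultimately show ?thesis using 3(2)[OF qP _ nn] False 3(7) by auto
    qed
  qed (auto simp: paths_def)
  then show "0 \<le> height_at P x" "?C P x" "x < b \<longrightarrow> \<bar>height_at P (x + 1) - height_at P x\<bar> \<le> 1"
    by blast+
qed

text \<open>A discrete intermediate value argument on the common range from \<open>a'\<close> to
  \<open>b\<close>. At equal heights the paths share a vertex: the current one or, halfway through
  horizontal steps, the common left end. If they never agree, \<open>P\<close> stays strictly above
  \<open>P'\<close>, which is impossible at \<open>b\<close>.\<close>

lemma crossing_paths_meet:
  assumes P: "P \<in> paths lstep (a, 0) (b, 0)" and P': "P' \<in> paths lstep (a', 0) (b', 0)"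
    and "even a" "even a'" "a \<le> a'" "a' \<le> b" "b \<le> b'"
  shows "set P \<inter> set P' \<noteq> {}"
proof
  assume disj: "set P \<inter> set P' = {}"
  note H = height_at_cases[OF P] and H' = height_at_cases[OF P']
  have ev: "even (a + 0)" "even (a' + 0)" using assms by auto
  have neq: "height_at P x \<noteq> height_at P' x" if "a' \<le> x" "x \<le> b" for x
    using H(2)[of x] H'(2)[of x] ev that assms(5-7) disj by auto
  have "height_at P' x < height_at P x" if "a' \<le> x" "x \<le> b" for x
    using that
  proof (induction x rule: int_ge_induct)
    case base
    then show ?case
      using height_at_start[OF P'] neq[of a'] H(1)[of a'] ev assms(5-7) by auto
  next
    case (step x)
    have lt: "height_at P' x < height_at P x" and xb: "x < b" using step by auto
    have d: "\<bar>height_at P (x + 1) - height_at P x\<bar> \<le> 1" "\<bar>height_at P' (x + 1) - height_at P' x\<bar> \<le> 1"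
      using H(3)[of x] H'(3)[of x] ev assms(5-7) step xb by auto
    have stay: "odd (x + height_at P x) \<Longrightarrow> height_at P (x + 1) = height_at P x"
      "odd (x + height_at P' x) \<Longrightarrow> height_at P' (x + 1) = height_at P' x"
      using H(2)[of x] H'(2)[of x] ev assms(5-7) step xb by auto
    show ?case
    proof (rule ccontr)
      assume "\<not> ?case"
      then have "height_at P (x + 1) < height_at P' (x + 1)" using neq[of "x + 1"] step by simp
      \<comment> \<open>Exchanging order in one unit requires distance 1 and both heights to change.
        At distance 1 the parities differ, so one path is halfway through a horizontal step and
        keeps its height.\<close>
      then have "height_at P x = height_at P' x + 1" "height_at P (x + 1) \<noteq> height_at P x"
        "height_at P' (x + 1) \<noteq> height_at P' x" using lt d by linarith+
      then show False using stay by auto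
    qed
  qed
  from this[of b] show False
    using height_at_end[OF P] H'(1)[of b] ev assms(5-7) by auto
qed

text \<open>In \<open>lstep\<close> the height bounds are attached to both ends of a step. This
  leaves only the first vertex unchecked in a path without steps, and it lies at height 0.\<close>

lemma is_lpath_iff: "is_lpath r m P (x, 0) E \<longleftrightarrow> P \<in> paths lstep (x, 0) E"
proof
  assume L: "is_lpath r m P (x, 0) E"
  then have "lstep (P ! i) (P ! Suc i)" if "Suc i < length P" for i
    using that by (auto simp: is_lpath_def lstep_def)
  then show "P \<in> paths lstep (x, 0) E"
    using L by (auto simp: is_lpath_def paths_def successively_conv_nth)
next
  assume L: "P \<in> paths lstep (x, 0) E"
  then have st: "lstep (P ! i) (P ! Suc i)" if "Suc i < length P" for i
    using that by (auto simp: paths_def successively_conv_nth)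
  have "snd p \<in> {0..int (NN r m)}" if pP: "p \<in> set P" for p
  proof -
    obtain i where i: "i < length P" "p = P ! i" using pP unfolding in_set_conv_nth by blast
    show ?thesis
    proof (cases i)
      case 0
      then have "p = (x, 0)" using L i by (auto simp: paths_def hd_conv_nth)
      then show ?thesis by simp
    next
      case (Suc j)
      then show ?thesis using st[of j] i by (auto simp: lstep_def)
    qed
  qed
  moreover have "step_ok r m (P ! i) (P ! (i + 1))" if "i < length P - 1" for i
    using st[of i] that by (simp add: lstep_def)
  ultimately show "is_lpath r m P (x, 0) E"
    using L by (auto simp: is_lpath_def paths_def)
qed

text \<open>Ends are numbered from right to left, so disjoint paths must be nested arches. If
  \<open>i < j\<close> but \<open>\<sigma> i\<close> is not below \<open>\<sigma> j\<close>, the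
  arches are not nested and meet; the bound on \<open>n\<close> puts every start weakly left of
  every end. A strictly increasing permutation is the identity.\<close>

lemma disjoint_families_unpermuted:
  fixes n :: int
  assumes n: "int k - 1 \<le> n" and \<sigma>: "\<sigma> permutes {0..<k}"
    and f: "f \<in> families lstep k (\<lambda>i. (2 * int i, 0)) ((\<lambda>j. (2 * n + 2 * int k - 2 * int j - 2, 0)) \<circ> \<sigma>)"
    and disj: "vertex_disjoint k f"
  shows "\<sigma> = id"
proof -
  have less: "\<sigma> i < \<sigma> j" if "i < j" "j < k" for i j
  proof (rule ccontr)
    assume "\<not> \<sigma> i < \<sigma> j"
    have "\<sigma> i < k" using permutes_in_image[OF \<sigma>, of i] that by simp
    then have "set (f i) \<inter> set (f j) \<noteq> {}"
      using that n \<open>\<not> \<sigma> i < \<sigma> j\<close> families_mem[OF f, of i] families_mem[OF f, of j]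
      by (intro crossing_paths_meet[where a = "2 * int i" and a' = "2 * int j"
          and b = "2 * n + 2 * int k - 2 * int (\<sigma> i) - 2" and b' = "2 * n + 2 * int k - 2 * int (\<sigma> j) - 2"]) auto
    then show False using disj that by (simp add: vertex_disjoint_def)
  qed
  have "i \<le> \<sigma> i" if "i < k" for i
    using that
  proof (induction i)
    case (Suc i)
    then show ?case using less[of i "Suc i"] by simp
  qed simp
  then show ?thesis using permutes_natset_ge[OF \<sigma>] by simp
qed

theorem R_eq_sum_disjoint_paths:
  fixes n :: int
  assumes k: "k \<le> r" and n: "n \<ge> int k - 1"
  shows "R k n = (R 1 0) ^ k *
    (\<Sum>Ps \<in> {Ps. length Ps = k \<and>
          (\<forall>i<k. is_lpath r m (Ps!i) (2 * int i, 0) (2*n + 2 * int k - 2 * int i - 2, 0)) \<and>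
          (\<forall>i<k. \<forall>j<k. i \<noteq> j \<longrightarrow> set (Ps!i) \<inter> set (Ps!j) = {})}.
       \<Prod>i<k. path_wt r m R (Ps!i))" (is "_ = _ * (\<Sum>Ps\<in>?S. _)")
proof -
  define a b where "a i = (2 * int i, 0 :: int)" and "b j = (2 * n + 2 * int k - 2 * int j - 2, 0 :: int)" for i j
  define G where "G = mat k k (\<lambda>(i, j). psum (a i) (b j))"
  have "R k n = Q k n" using k by (simp add: Q_eq)
  also have "\<dots> = det (mat k k (\<lambda>(i, j). R 1 (n + int k - 1 - int i - int j)))"
    using hankel_det[of k n] k by simp
  also have "mat k k (\<lambda>(i, j). R 1 (n + int k - 1 - int i - int j)) = R 1 0 \<cdot>\<^sub>m G"
  proof (rule eq_matI)
    fix i j assume "i < dim_row (R 1 0 \<cdot>\<^sub>m G)" "j < dim_col (R 1 0 \<cdot>\<^sub>m G)"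
    then have ij: "i < k" "j < k" by (auto simp: G_def)
    \<comment> \<open>The horizontal distance from \<open>a i\<close> to \<open>b j\<close> is twice
      \<open>n + int k - 1 - int i - int j\<close>, with indices starting from 0, and the start is
      the root.\<close>
    then have "R 1 0 * psum (a i) (b j) = T 0 (n + int k - 1 - int i - int j)"
      using n psum_eq_T[of 0 "fst (b j)" "fst (a i)" "n + int k - 1 - int i - int j"]
      by (simp add: a_def b_def)
    then show "mat k k (\<lambda>(i, j). R 1 (n + int k - 1 - int i - int j)) $$ (i, j) = (R 1 0 \<cdot>\<^sub>m G) $$ (i, j)"
      using ij by (simp add: G_def T_0)
  qed (auto simp: G_def)
  also have "det \<dots> = R 1 0 ^ k * det G" by (simp add: G_def)
  also have "det G = (\<Sum>f | f \<in> families lstep k a b \<and> vertex_disjoint k f. \<Prod>i<k. weight (step_wt r m R) (f i))"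
    unfolding G_def
  proof (rule lindstrom_gessel_viennot)
    show "\<sigma> = id" if "\<sigma> permutes {0..<k}" "f \<in> families lstep k a (b \<circ> \<sigma>)" "vertex_disjoint k f" for \<sigma> f
      using disjoint_families_unpermuted[OF n that(1) _ that(3)] that(2)
      unfolding a_def[abs_def] b_def[abs_def] by blast
  qed
  also have "\<dots> = (\<Sum>Ps\<in>?S. \<Prod>i<k. path_wt r m R (Ps ! i))"
  proof (rule sum.reindex_bij_witness[of _ "\<lambda>Ps. restrict ((!) Ps) {0..<k}" "\<lambda>f. map f [0..<k]"])
    fix f assume "f \<in> {f \<in> families lstep k a b. vertex_disjoint k f}"
    then have f: "f \<in> families lstep k a b" and d: "vertex_disjoint k f" by auto
    show "restrict ((!) (map f [0..<k])) {0..<k} = f"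
      using families_arb[OF f] by (auto simp: fun_eq_iff restrict_def)
    show "map f [0..<k] \<in> ?S"
      using families_mem[OF f] d by (simp add: is_lpath_iff a_def b_def vertex_disjoint_def)
    show "(\<Prod>i<k. path_wt r m R (map f [0..<k] ! i)) = (\<Prod>i<k. weight (step_wt r m R) (f i))"
      by (simp add: path_wt_def weight_conv_prod)
  next
    fix Ps assume Ps: "Ps \<in> ?S"
    then show "map (restrict ((!) Ps) {0..<k}) [0..<k] = Ps"
      by (auto intro!: nth_equalityI)
    show "restrict ((!) Ps) {0..<k} \<in> {f \<in> families lstep k a b. vertex_disjoint k f}"
      using Ps by (auto simp: families_def vertex_disjoint_def is_lpath_iff a_def b_def)
  qed
  finally show ?thesis .
qed

end

theorem mainTheorem13:
  fixes r k :: nat and n :: int and m :: "nat \<Rightarrow> int" and R :: "nat \<Rightarrow> int \<Rightarrow> 'a::field"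
  assumes "r \<ge> 1"
    and "qsys r R"
    and "\<forall>\<alpha>\<in>{1..r}. \<forall>j. R \<alpha> j \<noteq> 0"
    and "asc_motzkin r m"
    and "1 \<le> k" and "k \<le> r" and "n \<ge> int k - 1"
  shows "R k n = (R 1 0) ^ k *
    (\<Sum>Ps \<in> {Ps. length Ps = k \<and>
          (\<forall>i<k. is_lpath r m (Ps!i) (2 * int i, 0) (2*n + 2 * int k - 2 * int i - 2, 0)) \<and>
          (\<forall>i<k. \<forall>j<k. i \<noteq> j \<longrightarrow> set (Ps!i) \<inter> set (Ps!j) = {})}.
       \<Prod>i<k. path_wt r m R (Ps!i))"
proof -
  interpret motzkin_qsys r R m
    by unfold_locales (use assms in auto)
  show ?thesis using assms(6,7) by (rule R_eq_sum_disjoint_paths)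
qed

end
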